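(* Let $B_1\subset\mathbb{R}^3$ be the unit ball and $S_1=\partial B_1$. Let $u$ be the solution of $$u_{tt}-\Delta u=0,\quad x\in\mathbb{R}^3,\ t>0,\qquad u|_{t=0}=a(x),\quad u_t|_{t=0}=b(x),$$ where the supports of $a$ and $b$ are located inside $S_1$, and let $F:=u|_{S_1\times[0,T]}$ with $T\geqslant 2$. Let $v$ be the solution of the exterior initial boundary value problem $$v_{tt}-\Delta v=0,\quad x\in\mathbb{R}^3\setminus B_1,\ t>0,\qquad v|_{t=0}=0,\ v_t|_{t=0}=0,\qquad v|_{S_1\times[0,T]}=F,$$ and set $V:=v(\cdot,T)$, $V':=v_t(\cdot,T)$, so that $V,V'$ are supported in $B_{T+1}\setminus B_1$. Let $w$ be the solution of the Cauchy problem backward in time $$w_{tt}-\Delta w=0,\quad x\in\mathbb{R}^3,\ t<T,\qquad w|_{t=T}=V,\quad w_t|_{t=T}=V'.$$ Then the initial data are recovered in the unit ball by $$a(x)=w(x,0),\qquad b(x)=w_t(x,0).$$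
   Context: $B_{T+1}$ is the ball of radius $T+1$ centred at the origin. $V$ and $V'$ are regarded as functions on $\mathbb{R}^3$ vanishing in $B_1$. *)

theory Defs
  imports "HOL-Analysis.Analysis"
begin

text \<open>
  Solutions are classical: twice continuously differentiable in the open space-time domain
  and continuously differentiable up to its boundary, which includes the initial (or final)
  time. Derivatives at boundary points are taken within the domain, hence are one-sided there.
\<close>

definition C1_on :: "('a::euclidean_space \<Rightarrow> real) \<Rightarrow> 'a set \<Rightarrow> bool" where
  "C1_on f S \<longleftrightarrow>
     (\<exists>G. continuous_on S G \<and>
          (\<forall>p\<in>S. (f has_derivative (\<lambda>h. G p \<bullet> h)) (at p within S)))"

definition C2_on :: "('a::euclidean_space \<Rightarrow> real) \<Rightarrow> 'a set \<Rightarrow> bool" where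
  "C2_on f S \<longleftrightarrow>
     (\<exists>G. (\<forall>p\<in>S. (f has_derivative (\<lambda>h. G p \<bullet> h)) (at p within S)) \<and>
          (\<forall>e\<in>Basis. C1_on (\<lambda>p. G p \<bullet> e) S))"

definition supp :: "('a::topological_space \<Rightarrow> real) \<Rightarrow> 'a set" where
  "supp f = closure {x. f x \<noteq> 0}"

definition laplacian :: "(real^3 \<Rightarrow> real) \<Rightarrow> real^3 \<Rightarrow> real" where
  "laplacian f x = (\<Sum>i\<in>UNIV. deriv (deriv (\<lambda>s. f (x + s *\<^sub>R axis i 1))) 0)"

definition time_deriv ::
    "real set \<Rightarrow> (real^3 \<Rightarrow> real \<Rightarrow> real) \<Rightarrow> real^3 \<Rightarrow> real \<Rightarrow> real" where
  "time_deriv J u x t = vector_derivative (u x) (at t within J)"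

text \<open>\<open>D\<close> is an open set in space, \<open>J\<close> a closed time interval.\<close>

definition wave_solution ::
    "(real^3) set \<Rightarrow> real set \<Rightarrow> (real^3 \<Rightarrow> real \<Rightarrow> real) \<Rightarrow> bool" where
  "wave_solution D J u \<longleftrightarrow>
     C2_on (\<lambda>(x, t). u x t) (D \<times> interior J) \<and>
     C1_on (\<lambda>(x, t). u x t) (closure D \<times> J) \<and>
     (\<forall>x\<in>D. \<forall>t\<in>interior J. deriv (deriv (u x)) t - laplacian (\<lambda>y. u y t) x = 0)"

definition cauchy_solution ::
    "real set \<Rightarrow> real \<Rightarrow> (real^3 \<Rightarrow> real) \<Rightarrow> (real^3 \<Rightarrow> real) \<Rightarrow>
     (real^3 \<Rightarrow> real \<Rightarrow> real) \<Rightarrow> bool" where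
  "cauchy_solution J t0 f g u \<longleftrightarrow>
     wave_solution UNIV J u \<and>
     (\<forall>x. u x t0 = f x) \<and> (\<forall>x. time_deriv J u x t0 = g x)"

text \<open>
  The boundary data determine the exterior solution only on the time interval from 0 to \<open>T\<close>,
  so this is where it is considered. The closure of \<open>- cball 0 1\<close> is \<open>- ball 0 1\<close>.
\<close>

definition exterior_solution ::
    "real \<Rightarrow> (real^3 \<Rightarrow> real \<Rightarrow> real) \<Rightarrow> (real^3 \<Rightarrow> real \<Rightarrow> real) \<Rightarrow> bool" where
  "exterior_solution T F v \<longleftrightarrow>
     wave_solution (- cball 0 1) {0..T} v \<and>
     (\<forall>x\<in>- ball 0 1. v x 0 = 0 \<and> time_deriv {0..T} v x 0 = 0) \<and>
     (\<forall>x\<in>sphere 0 1. \<forall>t\<in>{0..T}. v x t = F x t)"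

end

theory Submission
  imports Defs
begin

text \<open>
  Since \<open>u\<close> and \<open>v\<close> have the same boundary values and both vanish outside the ball at time 0, they agree
  outside the ball up to time \<open>T\<close>. By the strong Huygens principle \<open>u\<close> has left the unit ball by
  time \<open>T \<ge> 2\<close>, so \<open>V\<close> and \<open>V'\<close> are the values of \<open>u\<close> and \<open>u\<^sub>t\<close> at time \<open>T\<close> on the whole space, and
  uniqueness of the backward Cauchy problem gives \<open>w = u\<close> on \<open>[0, T]\<close>.

  Uniqueness comes from an energy estimate with the smooth cone weight \<open>((R - t)\<^sup>2 - |x - y|\<^sup>2)\<^sub>+\<^sup>2\<close>; a cutoff
  near the sphere compensates for second derivatives existing only in the open exterior.
  For Huygens' principle, \<open>u\<close> is paired with \<open>q = Im 1/((t - t\<^sub>1 - i\<epsilon>)\<^sup>2 - |x - x\<^sub>0|\<^sup>2)\<close>, a global smooth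
  solution that tends to 0 away from the light cone of \<open>(x\<^sub>0, t\<^sub>1)\<close>, while at \<open>t = t\<^sub>1\<close> it has
  \<open>q = 0\<close> and \<open>q\<^sub>t = 2\<epsilon>/(\<epsilon>\<^sup>2 + |x - x\<^sub>0|\<^sup>2)\<^sup>2\<close>, an approximate identity. As the pairing
  \<open>\<integral>(u q\<^sub>t - u\<^sub>t q) dx\<close> is conserved, \<open>u(x\<^sub>0, t\<^sub>1) = 0\<close> whenever the data lie inside the cone.
\<close>

section \<open>Calculus\<close>

text \<open>Solutions have second derivatives only in the open domain and at interior times, so the
  differentiated identities are available neither on the sphere nor at time 0. Every flux is
  therefore arranged to vanish outside a box, by a weight or by finite propagation speed, and
  integration by parts reduces to one fact: a directional derivative of a function supported in a
  box has integral 0. No surface integral occurs. The cutoff near the sphere costs a flux term with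
  a gradient of size \<open>1/\<delta>\<close> on a shell of thickness comparable to \<delta>. It is
  harmless because zero boundary values make the time derivative vanish on the sphere. For Huygens'
  principle the factor \<open>2 \<epsilon>\<close> is divided out of the pairing. At an early time,
  when the wave lies strictly inside the cone, the pairing then stays bounded as \<epsilon> tends to
  0, whereas at \<open>t\<^sub>1\<close> a nonzero value \<open>u(x\<^sub>0, t\<^sub>1)\<close>
  would make it grow like \<open>1/\<epsilon>\<close>. Conservation excludes this, so no limit of an
  approximate identity has to be computed.\<close>

lemma continuous_on_zero_extension:
  fixes f :: "'a::topological_space \<Rightarrow> 'b::real_normed_vector"
  assumes "open A" "open B" "S \<subseteq> A \<union> B"
    and A: "continuous_on (S \<inter> A) f" and B: "\<And>x. x \<in> S \<Longrightarrow> x \<in> B \<Longrightarrow> f x = 0"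
  shows "continuous_on S f"
proof -
  have S: "S = (S \<inter> A) \<union> (S \<inter> B)" using assms(3) by blast
  have "continuous_on (S \<inter> B) f"
    using B continuous_on_cong[of "S \<inter> B" "S \<inter> B" f "\<lambda>_. 0"] by simp
  then have "continuous_on ((S \<inter> A) \<union> (S \<inter> B)) f"
    using A assms(1,2) S by (intro continuous_on_Un_local_open) auto
  then show ?thesis using S by simp
qed

text \<open>The standard way below to see that a gradient vanishes: its component and 0 are both
  derivatives along the same line, hence equal.\<close>

lemma has_directional_derivative_zero_outside:
  fixes f :: "'a::real_normed_vector \<Rightarrow> real"
  assumes "closed K" "\<And>x. x \<notin> K \<Longrightarrow> f x = 0" "x \<notin> K"
  shows "((\<lambda>s. f (x + s *\<^sub>R e)) has_real_derivative 0) (at 0)"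
proof -
  have "open ((\<lambda>s. x + s *\<^sub>R e) -` (- K))"
    by (intro open_vimage continuous_intros) (use assms(1) in auto)
  moreover have "0 \<in> (\<lambda>s. x + s *\<^sub>R e) -` (- K)" using assms(3) by simp
  ultimately show ?thesis
    by (rule has_field_derivative_transform_within_open[OF DERIV_const]) (auto simp: assms(2))
qed

text \<open>Translating \<open>f\<close> along \<open>e\<close> does not change its integral;
  differentiating the translated integral at 0 under the integral sign produces the integral of
  \<open>g\<close>.\<close>

lemma integral_directional_derivative_eq_0:
  fixes f g :: "'a::euclidean_space \<Rightarrow> real"
  assumes der: "\<And>x. ((\<lambda>s. f (x + s *\<^sub>R e)) has_real_derivative g x) (at 0)"
    and cf: "continuous_on UNIV f" and cg: "continuous_on UNIV g"
    and f0: "\<And>x. x \<notin> cbox a b \<Longrightarrow> f x = 0"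
  shows "integral (cbox a b) g = 0"
proof -
  \<comment> \<open>The enlarged box contains all translates of \<open>cbox a b\<close> by
    \<open>s *\<^sub>R e\<close> with |s| < 1, so small translations lose no mass.\<close>
  define c where "c = a - norm e *\<^sub>R One"
  define d where "d = b + norm e *\<^sub>R One"
  have g0: "g x = 0" if "x \<notin> cbox a b" for x
    using DERIV_unique[OF der has_directional_derivative_zero_outside[OF closed_cbox f0 that]] by simp
  have der': "((\<lambda>s. f (x + s *\<^sub>R e)) has_real_derivative g (x + s *\<^sub>R e)) (at s)" for x s
  proof -
    have "((\<lambda>r. f (x + (r + s) *\<^sub>R e)) has_real_derivative g (x + s *\<^sub>R e)) (at 0)"
      using der[of "x + s *\<^sub>R e"] by (simp add: algebra_simps)
    then show ?thesis
      using DERIV_shift[of "\<lambda>r. f (x + r *\<^sub>R e)" _ 0 s] by simp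
  qed
  have const: "integral (cbox c d) (\<lambda>x. f (x + s *\<^sub>R e)) = integral (cbox a b) f"
    if "s \<in> {-1<..<1}" for s
  proof -
    have *: "\<bar>s * (e \<bullet> i)\<bar> \<le> norm e" if "i \<in> Basis" for i
    proof -
      have "\<bar>s\<bar> * \<bar>e \<bullet> i\<bar> \<le> 1 * norm e"
        using \<open>s \<in> _\<close> Basis_le_norm[OF that, of e] by (intro mult_mono) auto
      then show ?thesis by (simp add: abs_mult)
    qed
    have "cbox a b \<subseteq> cbox (c + s *\<^sub>R e) (d + s *\<^sub>R e)"
    proof
      fix x assume x: "x \<in> cbox a b"
      show "x \<in> cbox (c + s *\<^sub>R e) (d + s *\<^sub>R e)"
        unfolding mem_box
      proof
        fix i :: 'a assume i: "i \<in> Basis"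
        have "a \<bullet> i \<le> x \<bullet> i" "x \<bullet> i \<le> b \<bullet> i" using x i by (auto simp: mem_box)
        then show "(c + s *\<^sub>R e) \<bullet> i \<le> x \<bullet> i \<and> x \<bullet> i \<le> (d + s *\<^sub>R e) \<bullet> i"
          using *[OF i] i by (auto simp: c_def d_def algebra_simps abs_le_iff)
      qed
    qed
    moreover have "(f has_integral integral (cbox a b) f) (cbox a b)"
      by (intro integrable_integral integrable_continuous continuous_on_subset[OF cf]) auto
    ultimately have "(f has_integral integral (cbox a b) f) (cbox (c + s *\<^sub>R e) (d + s *\<^sub>R e))"
      using has_integral_on_superset f0 by blast
    then have "((f \<circ> (+) (s *\<^sub>R e)) has_integral integral (cbox a b) f) (cbox c d)"
      by (simp add: has_integral_shift_cbox_iff)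
    then show ?thesis by (auto simp: o_def add.commute intro: integral_unique)
  qed
  have "((\<lambda>s. integral (cbox c d) (\<lambda>x. f (x + s *\<^sub>R e))) has_real_derivative
      integral (cbox c d) (\<lambda>x. g (x + 0 *\<^sub>R e))) (at 0 within {-1<..<1})"
  proof (rule leibniz_rule_field_derivative)
    show "((\<lambda>s. f (x + s *\<^sub>R e)) has_real_derivative g (x + s *\<^sub>R e)) (at s within {-1<..<1})" for x s
      using der' by (rule has_field_derivative_at_within)
    show "(\<lambda>x. f (x + s *\<^sub>R e)) integrable_on cbox c d" for s
      by (intro integrable_continuous continuous_on_compose2[OF cf] continuous_intros) auto
    show "continuous_on ({- 1<..<1} \<times> cbox c d) (\<lambda>(s, x). g (x + s *\<^sub>R e))"
      unfolding case_prod_unfold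
      by (intro continuous_on_compose2[OF cg] continuous_intros) auto
  qed auto
  then have "((\<lambda>s. integral (cbox c d) (\<lambda>x. f (x + s *\<^sub>R e))) has_real_derivative
      integral (cbox c d) g) (at 0)"
    using at_within_open[of "0::real" "{-1<..<1}"] by simp
  then have "((\<lambda>s. integral (cbox a b) f) has_real_derivative integral (cbox c d) g) (at 0)"
    by (rule has_field_derivative_transform_within_open[where S="{-1<..<1}"]) (auto simp: const)
  then have "integral (cbox c d) g = 0" using DERIV_const DERIV_unique by blast
  moreover have "(g has_integral integral (cbox a b) g) (cbox c d)"
  proof (rule has_integral_on_superset[OF _ g0])
    show "(g has_integral integral (cbox a b) g) (cbox a b)"
      by (intro integrable_integral integrable_continuous continuous_on_subset[OF cg]) auto
    show "cbox a b \<subseteq> cbox c d"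
      by (rule subset_box_imp) (auto simp: c_def d_def algebra_simps)
  qed
  ultimately show ?thesis by (simp add: integral_unique)
qed

section \<open>Symmetry of mixed second derivatives\<close>

lemma second_difference_mvt:
  fixes f fs fst :: "real \<Rightarrow> real \<Rightarrow> real"
  assumes h: "0 < h"
    and fs: "\<And>s t. 0 \<le> s \<Longrightarrow> s \<le> h \<Longrightarrow> 0 \<le> t \<Longrightarrow> t \<le> h \<Longrightarrow>
      ((\<lambda>s. f s t) has_real_derivative fs s t) (at s)"
    and fst: "\<And>s t. 0 \<le> s \<Longrightarrow> s \<le> h \<Longrightarrow> 0 \<le> t \<Longrightarrow> t \<le> h \<Longrightarrow>
      ((\<lambda>t. fs s t) has_real_derivative fst s t) (at t)"
  obtains s t where "0 < s" "s < h" "0 < t" "t < h"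
    "f h h - f h 0 - f 0 h + f 0 0 = h\<^sup>2 * fst s t"
proof -
  have "\<exists>s>0. s < h \<and> (f h h - f h 0) - (f 0 h - f 0 0) = (h - 0) * (fs s h - fs s 0)"
    by (rule MVT2[OF h]) (use h in \<open>auto intro!: derivative_eq_intros fs\<close>)
  then obtain s where s: "0 < s" "s < h" "(f h h - f h 0) - (f 0 h - f 0 0) = h * (fs s h - fs s 0)"
    by auto
  have "\<exists>t>0. t < h \<and> fs s h - fs s 0 = (h - 0) * fst s t"
    by (rule MVT2[OF h]) (use h s in \<open>auto intro!: derivative_eq_intros fst\<close>)
  then obtain t where "0 < t" "t < h" "fs s h - fs s 0 = h * fst s t" by auto
  with s show thesis by (intro that[of s t]) (auto simp: power2_eq_square)
qed

text \<open>One second difference over a small square is evaluated in both orders of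
  differentiation. This gives \<open>fst\<close> and \<open>fts\<close> the same value at two points
  near the origin, and continuity carries the equality to the origin.\<close>

lemma mixed_partials_eq:
  fixes f fs ft fst fts :: "real \<Rightarrow> real \<Rightarrow> real"
  assumes d: "0 < d"
    and fs: "\<And>s t. \<bar>s\<bar> < d \<Longrightarrow> \<bar>t\<bar> < d \<Longrightarrow> ((\<lambda>s. f s t) has_real_derivative fs s t) (at s)"
    and fst: "\<And>s t. \<bar>s\<bar> < d \<Longrightarrow> \<bar>t\<bar> < d \<Longrightarrow> ((\<lambda>t. fs s t) has_real_derivative fst s t) (at t)"
    and ft: "\<And>s t. \<bar>s\<bar> < d \<Longrightarrow> \<bar>t\<bar> < d \<Longrightarrow> ((\<lambda>t. f s t) has_real_derivative ft s t) (at t)"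
    and fts: "\<And>s t. \<bar>s\<bar> < d \<Longrightarrow> \<bar>t\<bar> < d \<Longrightarrow> ((\<lambda>s. ft s t) has_real_derivative fts s t) (at s)"
    and cst: "isCont (\<lambda>(s, t). fst s t) (0, 0)" and cts: "isCont (\<lambda>(s, t). fts s t) (0, 0)"
  shows "fst 0 0 = fts 0 0"
proof (rule ccontr)
  assume neq: "fst 0 0 \<noteq> fts 0 0"
  define r where "r = \<bar>fst 0 0 - fts 0 0\<bar> / 2"
  have r: "r > 0" using neq by (simp add: r_def)
  obtain d1 where d1: "d1 > 0" "\<And>s t. dist (s, t) (0::real, 0::real) < d1 \<Longrightarrow> \<bar>fst s t - fst 0 0\<bar> < r"
    using cst[unfolded continuous_at_eps_delta, rule_format, OF r] by (auto simp: dist_real_def)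
  obtain d2 where d2: "d2 > 0" "\<And>s t. dist (s, t) (0::real, 0::real) < d2 \<Longrightarrow> \<bar>fts s t - fts 0 0\<bar> < r"
    using cts[unfolded continuous_at_eps_delta, rule_format, OF r] by (auto simp: dist_real_def)
  define h where "h = min (d / 2) (min (d1 / 2) (d2 / 2))"
  have h: "0 < h" "h < d" "2 * h \<le> d1" "2 * h \<le> d2" using d d1(1) d2(1) by (auto simp: h_def)
  have near: "dist (s, t) (0::real, 0::real) < 2 * h" if "0 < s" "s < h" "0 < t" "t < h" for s t
    using sqrt_sum_squares_le_sum_abs[of s t] that by (simp add: dist_Pair_Pair)
  obtain s t where 1: "0 < s" "s < h" "0 < t" "t < h"
    "f h h - f h 0 - f 0 h + f 0 0 = h\<^sup>2 * fst s t"
    by (rule second_difference_mvt[of h f fs fst]) (use h fs fst in auto)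
  obtain t' s' where 2: "0 < t'" "t' < h" "0 < s'" "s' < h"
    "f h h - f 0 h - f h 0 + f 0 0 = h\<^sup>2 * fts s' t'"
    by (rule second_difference_mvt[of h "\<lambda>t s. f s t" "\<lambda>t s. ft s t" "\<lambda>t s. fts s t"])
       (use h ft fts in auto)
  have "h\<^sup>2 * fst s t = h\<^sup>2 * fts s' t'" using 1(5) 2(5) by linarith
  then have "fst s t = fts s' t'" using h by simp
  moreover have "\<bar>fst s t - fst 0 0\<bar> < r" "\<bar>fts s' t' - fts 0 0\<bar> < r"
    using d1(2)[of s t] d2(2)[of s' t'] near[of s t] near[of s' t'] 1 2 h by auto
  ultimately show False using r unfolding r_def by (smt (verit) field_sum_of_halves)
qed

section \<open>Derivatives of classical solutions\<close>

text \<open>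
  \<open>zxx\<close> lists the three unmixed second space derivatives (there is no Hessian), and \<open>zxt\<close> is both the gradient of \<open>zt\<close> and the time derivative of \<open>zx\<close>.
\<close>

locale wave_jet =
  fixes D :: "(real^3) set" and J :: "real set"
    and z zt ztt :: "real^3 \<Rightarrow> real \<Rightarrow> real"
    and zx zxt zxx :: "real^3 \<Rightarrow> real \<Rightarrow> real^3"
  assumes open_D: "open D"
    and z_t: "\<And>x t. x \<in> closure D \<Longrightarrow> t \<in> J \<Longrightarrow>
      (z x has_real_derivative zt x t) (at t within J)"
    and z_x: "\<And>x t i. x \<in> D \<Longrightarrow> t \<in> J \<Longrightarrow>
      ((\<lambda>s. z (x + s *\<^sub>R axis i 1) t) has_real_derivative zx x t $ i) (at 0)"
    and zt_t: "\<And>x t. x \<in> D \<Longrightarrow> t \<in> interior J \<Longrightarrow>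
      (zt x has_real_derivative ztt x t) (at t)"
    and zt_x: "\<And>x t i. x \<in> D \<Longrightarrow> t \<in> interior J \<Longrightarrow>
      ((\<lambda>s. zt (x + s *\<^sub>R axis i 1) t) has_real_derivative zxt x t $ i) (at 0)"
    and zx_t: "\<And>x t i. x \<in> D \<Longrightarrow> t \<in> interior J \<Longrightarrow>
      ((\<lambda>r. zx x r $ i) has_real_derivative zxt x t $ i) (at t)"
    and zx_x: "\<And>x t i. x \<in> D \<Longrightarrow> t \<in> interior J \<Longrightarrow>
      ((\<lambda>s. zx (x + s *\<^sub>R axis i 1) t $ i) has_real_derivative zxx x t $ i) (at 0)"
    and wave: "\<And>x t. x \<in> D \<Longrightarrow> t \<in> interior J \<Longrightarrow> ztt x t = (\<Sum>i\<in>UNIV. zxx x t $ i)"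
    and cont_z: "continuous_on (closure D \<times> J) (\<lambda>p. z (fst p) (snd p))"
    and cont_zt: "continuous_on (closure D \<times> J) (\<lambda>p. zt (fst p) (snd p))"
    and cont_zx: "continuous_on (closure D \<times> J) (\<lambda>p. zx (fst p) (snd p))"
    and cont_ztt: "continuous_on (D \<times> interior J) (\<lambda>p. ztt (fst p) (snd p))"
    and cont_zxt: "continuous_on (D \<times> interior J) (\<lambda>p. zxt (fst p) (snd p))"
    and cont_zxx: "continuous_on (D \<times> interior J) (\<lambda>p. zxx (fst p) (snd p))"

text \<open>The restriction to \<open>T\<close> lets one statement cover spatial lines inside an
  open set and one-sided time derivatives at the ends of \<open>J\<close>.\<close>

lemma has_real_derivative_along_line:
  assumes "(f has_derivative (\<lambda>h. g \<bullet> h)) (at (p + s0 *\<^sub>R v) within S)"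
    and "\<And>s. s \<in> T \<Longrightarrow> p + s *\<^sub>R v \<in> S"
  shows "((\<lambda>s. f (p + s *\<^sub>R v)) has_real_derivative g \<bullet> v) (at s0 within T)"
proof -
  have "((\<lambda>s. p + s *\<^sub>R v) has_derivative (\<lambda>h. h *\<^sub>R v)) (at s0 within T)"
    by (auto intro!: derivative_eq_intros)
  moreover have "(f has_derivative (\<lambda>h. g \<bullet> h)) (at (p + s0 *\<^sub>R v) within (\<lambda>s. p + s *\<^sub>R v) ` T)"
    using assms by (auto intro: has_derivative_subset)
  ultimately have "((\<lambda>s. f (p + s *\<^sub>R v)) has_derivative (\<lambda>h. g \<bullet> (h *\<^sub>R v))) (at s0 within T)"
    by (rule has_derivative_in_compose)
  then show ?thesis by (simp add: has_field_derivative_def mult_commute_abs)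
qed

lemma wave_solution_jet:
  assumes sol: "wave_solution D J z" and oD: "open D"
  obtains zt ztt zx zxt zxx where "wave_jet D J z zt ztt zx zxt zxx"
proof -
  let ?z = "\<lambda>(x, t). z x t"
  define S where "S = D \<times> interior J"
  have oS: "open S" unfolding S_def by (intro open_Times oD open_interior)
  have SJ: "S \<subseteq> closure D \<times> J" 
    using closure_subset[of D] interior_subset[of J] by (auto simp: S_def)
  obtain G where Gc: "continuous_on (closure D \<times> J) G"
    and G: "\<And>p. p \<in> closure D \<times> J \<Longrightarrow> (?z has_derivative (\<lambda>h. G p \<bullet> h)) (at p within closure D \<times> J)"
    using sol unfolding wave_solution_def C1_on_def by blast
  obtain G2 where G2: "\<And>p. p \<in> S \<Longrightarrow> (?z has_derivative (\<lambda>h. G2 p \<bullet> h)) (at p within S)"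
    and G2C: "\<And>e. e \<in> Basis \<Longrightarrow> C1_on (\<lambda>p. G2 p \<bullet> e) S"
    using sol unfolding wave_solution_def C2_on_def S_def by blast
  have "\<forall>e\<in>Basis. \<exists>h. continuous_on S h \<and>
      (\<forall>p\<in>S. ((\<lambda>p. G2 p \<bullet> e) has_derivative (\<lambda>k. h p \<bullet> k)) (at p within S))"
    using G2C unfolding C1_on_def by blast
  then obtain H where Hc: "\<And>e. e \<in> Basis \<Longrightarrow> continuous_on S (H e)"
    and H2: "\<And>e p. e \<in> Basis \<Longrightarrow> p \<in> S \<Longrightarrow>
      ((\<lambda>p. G2 p \<bullet> e) has_derivative (\<lambda>k. H e p \<bullet> k)) (at p within S)"
    by metis
  \<comment> \<open>\<open>C1_on\<close> and \<open>C2_on\<close> each supply a gradient of their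
    own, one continuous up to the boundary and one differentiable inside. They coincide on the open
    set, so \<open>H\<close> differentiates \<open>G\<close> there.\<close>
  have GG2: "G p = G2 p" if "p \<in> S" for p
  proof -
    have "(?z has_derivative (\<lambda>h. G p \<bullet> h)) (at p)" "(?z has_derivative (\<lambda>h. G2 p \<bullet> h)) (at p)"
      using has_derivative_subset[OF G SJ] G2 that SJ at_within_open[OF that oS] by (force, force)
    then have "(\<lambda>h. G p \<bullet> h) = (\<lambda>h. G2 p \<bullet> h)" by (rule has_derivative_unique)
    then show ?thesis by (meson vector_eq_rdot ext)
  qed
  have H: "((\<lambda>p. G p \<bullet> e) has_derivative (\<lambda>k. H e p \<bullet> k)) (at p within S)"
    if "e \<in> Basis" "p \<in> S" for e p
    using H2[OF that] by (rule has_derivative_transform[OF that(2), rotated]) (simp add: GG2)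
  define ex :: "3 \<Rightarrow> (real^3) \<times> real" where "ex i = (axis i 1, 0)" for i
  define et :: "(real^3) \<times> real" where "et = (0, 1)"
  have B [simp]: "ex i \<in> Basis" "et \<in> Basis" for i
    by (auto simp: Basis_prod_def axis_in_Basis_iff ex_def et_def)
  have Gex: "g \<bullet> ex i = fst g $ i" and Get: "g \<bullet> et = snd g" for g i
    by (auto simp: ex_def et_def inner_prod_def inner_axis)
  define zt where "zt x t = snd (G (x, t))" for x t
  define zx where "zx x t = fst (G (x, t))" for x t
  define ztt where "ztt x t = snd (H et (x, t))" for x t
  define zxt where "zxt x t = fst (H et (x, t))" for x t
  define zxx :: "real^3 \<Rightarrow> real \<Rightarrow> real^3"
    where "zxx x t = (\<chi> i. fst (H (ex i) (x, t)) $ i)" for x t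
  have space_line: "((\<lambda>s. f (x + s *\<^sub>R axis i 1, t)) has_real_derivative fst g $ i) (at r)"
    if "(f has_derivative (\<lambda>h. g \<bullet> h)) (at (x + r *\<^sub>R axis i 1, t) within S')"
      "D \<times> {t} \<subseteq> S'" "x + r *\<^sub>R axis i 1 \<in> D" for f g x S' r i and t :: real
  proof -
    let ?T = "(\<lambda>s. x + s *\<^sub>R axis i 1) -` D"
    have "((\<lambda>s. f ((x, t) + s *\<^sub>R ex i)) has_real_derivative g \<bullet> ex i) (at r within ?T)"
      by (rule has_real_derivative_along_line[of f g _ _ _ S']) (use that in \<open>auto simp: ex_def\<close>)
    moreover have "open ?T" by (intro open_vimage oD continuous_intros)
    then have "at r within ?T = at r" by (rule at_within_open[rotated]) (use that in simp)
    ultimately show ?thesis by (simp add: ex_def inner_prod_def inner_axis)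
  qed
  have time_line: "((\<lambda>s. f (x, s)) has_real_derivative snd g) (at t within J')"
    if "(f has_derivative (\<lambda>h. g \<bullet> h)) (at (x, t) within S')" "{x} \<times> J' \<subseteq> S'"
    for f g S' J' and x :: "real^3" and t :: real
  proof -
    have "((\<lambda>s. f ((x, 0) + s *\<^sub>R et)) has_real_derivative g \<bullet> et) (at t within J')"
      by (rule has_real_derivative_along_line[of f g _ _ _ S']) (use that in \<open>auto simp: et_def\<close>)
    then show ?thesis by (simp add: et_def inner_prod_def)
  qed
  have z_t: "(z x has_real_derivative zt x t) (at t within J)" if "x \<in> closure D" "t \<in> J" for x t
    using time_line[OF G[of "(x, t)"], of J] that by (auto simp: zt_def)
  have z_x: "((\<lambda>s. z (x + s *\<^sub>R axis i 1) t) has_real_derivative zx (x + r *\<^sub>R axis i 1) t $ i) (at r)"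
    if "x + r *\<^sub>R axis i 1 \<in> D" "t \<in> J" for x t i r
    using space_line[OF G[of "(x + r *\<^sub>R axis i 1, t)"]] that closure_subset[of D]
    by (auto simp: zx_def)
  have inS: "(x, t) \<in> S" if "x \<in> D" "t \<in> interior J" for x t using that by (simp add: S_def)
  have subS: "x \<in> D \<Longrightarrow> {x} \<times> interior J \<subseteq> S" "t \<in> interior J \<Longrightarrow> D \<times> {t} \<subseteq> S" for x t
    by (auto simp: S_def)
  have atJ: "at t within interior J = at t" if "t \<in> interior J" for t
    using that open_interior by (rule at_within_open)
  have zt_t: "(zt x has_real_derivative ztt x t) (at t)" if "x \<in> D" "t \<in> interior J" for x t
    using time_line[OF H[OF B(2) inS[OF that]] subS(1)[OF that(1)]] atJ[OF that(2)]
    by (simp add: zt_def[abs_def] ztt_def Get)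
  have zt_x: "((\<lambda>s. zt (x + s *\<^sub>R axis i 1) t) has_real_derivative zxt (x + r *\<^sub>R axis i 1) t $ i) (at r)"
    if "x + r *\<^sub>R axis i 1 \<in> D" "t \<in> interior J" for x t i r
    using space_line[OF H[OF B(2) inS[OF that]] subS(2)[OF that(2)] that(1)]
    by (simp add: zt_def zxt_def Get)
  have zx_t0: "((\<lambda>r. zx x r $ i) has_real_derivative snd (H (ex i) (x, t))) (at t)"
    if "x \<in> D" "t \<in> interior J" for x t i
    using time_line[OF H[OF B(1) inS[OF that]] subS(1)[OF that(1)]] atJ[OF that(2)]
    by (simp add: zx_def Gex)
  have zx_x: "((\<lambda>s. zx (x + s *\<^sub>R axis i 1) t $ i) has_real_derivative zxx (x + r *\<^sub>R axis i 1) t $ i) (at r)"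
    if "x + r *\<^sub>R axis i 1 \<in> D" "t \<in> interior J" for x t i r
    using space_line[OF H[OF B(1) inS[OF that]] subS(2)[OF that(2)] that(1)]
    by (simp add: zx_def zxx_def Gex)
  \<comment> \<open>Each gradient component comes with its own derivative, so the space-time entries
    of row \<open>ex i\<close> and row \<open>et\<close> still have to be identified before
    \<open>zxt\<close> can play both roles.\<close>
  have schwarz: "snd (H (ex i) (x, t)) = zxt x t $ i" if "x \<in> D" "t \<in> interior J" for x t i
  proof -
    obtain e1 where e1: "e1 > 0" "ball x e1 \<subseteq> D" using oD \<open>x \<in> D\<close> by (auto simp: open_contains_ball)
    obtain e2 where e2: "e2 > 0" "ball t e2 \<subseteq> interior J"
      using open_interior \<open>t \<in> interior J\<close> by (meson open_contains_ball)
    define d where "d = min e1 e2"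
    have d: "d > 0" using e1 e2 by (simp add: d_def)
    have inD: "x + s *\<^sub>R axis i 1 \<in> D" if "\<bar>s\<bar> < d" for s
      using e1(2) that by (intro subsetD[OF e1(2)]) (simp add: d_def dist_norm norm_axis_1)
    have inJ: "t + r \<in> interior J" if "\<bar>r\<bar> < d" for r
      using that by (intro subsetD[OF e2(2)]) (simp add: d_def dist_norm)
    have cont: "isCont (\<lambda>(s, r). f (x + s *\<^sub>R axis i 1, t + r)) (0, 0)"
      if "continuous_on S f" for f :: "_ \<Rightarrow> real"
    proof -
      have "isCont f (x + fst (0, 0) *\<^sub>R axis i 1, t + snd (0, 0))"
        using that inS[OF \<open>x \<in> D\<close> \<open>t \<in> interior J\<close>] oS
        by (simp add: continuous_on_eq_continuous_at)
      then have "isCont (\<lambda>p. f (x + fst p *\<^sub>R axis i 1, t + snd p)) (0, 0)"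
        by (rule isCont_o2[rotated]) (intro continuous_intros)
      then show ?thesis by (simp add: case_prod_unfold)
    qed
    have "(\<lambda>s r. snd (H (ex i) (x + s *\<^sub>R axis i 1, t + r))) 0 0 =
          (\<lambda>s r. zxt (x + s *\<^sub>R axis i 1) (t + r) $ i) 0 0"
    proof (rule mixed_partials_eq[OF d, where f = "\<lambda>s r. z (x + s *\<^sub>R axis i 1) (t + r)"
          and fs = "\<lambda>s r. zx (x + s *\<^sub>R axis i 1) (t + r) $ i"
          and ft = "\<lambda>s r. zt (x + s *\<^sub>R axis i 1) (t + r)"
          and fst = "\<lambda>s r. snd (H (ex i) (x + s *\<^sub>R axis i 1, t + r))"
          and fts = "\<lambda>s r. zxt (x + s *\<^sub>R axis i 1) (t + r) $ i"], goal_cases)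
      case (1 s r)
      then show ?case by (intro z_x inD subsetD[OF interior_subset inJ])
    next
      case (2 s r)
      then show ?case
        using DERIV_shift[of "\<lambda>r. zx (x + s *\<^sub>R axis i 1) r $ i" _ r t]
          zx_t0[OF inD[OF 2(1)] inJ[OF 2(2)], of i]
        by (simp add: add.commute)
    next
      case (3 s r)
      have "(z (x + s *\<^sub>R axis i 1) has_real_derivative zt (x + s *\<^sub>R axis i 1) (t + r)) (at (t + r))"
        using z_t[OF subsetD[OF closure_subset inD[OF 3(1)]] subsetD[OF interior_subset inJ[OF 3(2)]]]
          at_within_interior[OF inJ[OF 3(2)]] by simp
      then show ?case
        using DERIV_shift[of "z (x + s *\<^sub>R axis i 1)" _ r t] by (simp add: add.commute)
    next
      case (4 s r)
      then show ?case by (intro zt_x inD inJ)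
    next
      case 5
      show ?case by (rule cont[of "\<lambda>p. snd (H (ex i) p)"]) (intro continuous_intros Hc B)
    next
      case 6
      show ?case unfolding zxt_def
        by (rule cont[of "\<lambda>p. fst (H et p) $ i"]) (intro continuous_intros Hc B)
    qed
    then show ?thesis by simp
  qed
  have zx_t: "((\<lambda>r. zx x r $ i) has_real_derivative zxt x t $ i) (at t)"
    if "x \<in> D" "t \<in> interior J" for x t i
    using zx_t0[OF that] schwarz[OF that] by simp
  have wave: "ztt x t = (\<Sum>i\<in>UNIV. zxx x t $ i)" if "x \<in> D" "t \<in> interior J" for x t
  proof -
    have "deriv (z x) r = zt x r" if "r \<in> interior J" for r
      using z_t[of x r] \<open>x \<in> D\<close> closure_subset[of D] that interior_subset[of J]
      by (intro DERIV_imp_deriv) (auto simp: at_within_interior[OF that])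
    then have "deriv (deriv (z x)) t = deriv (zt x) t"
      using eventually_nhds_in_open[OF open_interior that(2)]
      by (intro deriv_cong_ev) (auto elim: eventually_mono)
    also have "\<dots> = ztt x t" by (intro DERIV_imp_deriv zt_t that)
    finally have 1: "deriv (deriv (z x)) t = ztt x t" .
    have "deriv (deriv (\<lambda>s. z (x + s *\<^sub>R axis i 1) t)) 0 = zxx x t $ i" for i
    proof -
      let ?T = "(\<lambda>s. x + s *\<^sub>R axis i 1) -` D"
      have T: "open ?T" "0 \<in> ?T" using that by (auto intro!: open_vimage oD continuous_intros)
      have "deriv (\<lambda>s. z (x + s *\<^sub>R axis i 1) t) s = zx (x + s *\<^sub>R axis i 1) t $ i" if "s \<in> ?T" for s
        using that \<open>t \<in> interior J\<close> interior_subset[of J] by (intro DERIV_imp_deriv z_x) auto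
      then have "deriv (deriv (\<lambda>s. z (x + s *\<^sub>R axis i 1) t)) 0
          = deriv (\<lambda>s. zx (x + s *\<^sub>R axis i 1) t $ i) 0"
        using eventually_nhds_in_open[OF T] by (intro deriv_cong_ev) (auto elim: eventually_mono)
      also have "\<dots> = zxx x t $ i"
        using zx_x[of x 0 i t] that by (intro DERIV_imp_deriv) auto
      finally show ?thesis .
    qed
    then have "laplacian (\<lambda>y. z y t) x = (\<Sum>i\<in>UNIV. zxx x t $ i)" by (simp add: laplacian_def)
    moreover have "deriv (deriv (z x)) t - laplacian (\<lambda>y. z y t) x = 0"
      using sol that unfolding wave_solution_def by blast
    ultimately show ?thesis using 1 by simp
  qed
  have "wave_jet D J z zt ztt zx zxt zxx"
  proof (unfold_locales, goal_cases)
    case 1 show ?case by (rule oD)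
  next
    case (3 x t i) then show ?case using z_x[of x 0 i t] by simp
  next
    case (5 x t i) then show ?case using zt_x[of x 0 i t] by simp
  next
    case (7 x t i) then show ?case using zx_x[of x 0 i t] by simp
  next
    case 9
    have "continuous_on (closure D \<times> J) ?z"
      unfolding continuous_on_eq_continuous_within
      using G has_derivative_continuous by blast
    then show ?case by (simp add: case_prod_unfold)
  next
    case 10 then show ?case unfolding zt_def by (auto intro!: continuous_intros Gc)
  next
    case 11 then show ?case unfolding zx_def by (auto intro!: continuous_intros Gc)
  next
    case 12 then show ?case unfolding ztt_def S_def[symmetric] by (auto intro!: continuous_intros Hc)
  next
    case 13 then show ?case unfolding zxt_def S_def[symmetric] by (auto intro!: continuous_intros Hc)
  next
    case 14 then show ?case unfolding zxx_def S_def[symmetric] by (auto intro!: continuous_intros Hc)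
  qed (use z_t zt_t zx_t wave in auto)
  then show thesis by (rule that)
qed

section \<open>Restriction, difference and time reversal of solutions\<close>

lemma wave_jet_restrict:
  assumes "wave_jet D J z zt ztt zx zxt zxx" "open D'" "D' \<subseteq> D" "J' \<subseteq> J"
  shows "wave_jet D' J' z zt ztt zx zxt zxx"
proof -
  interpret wave_jet D J z zt ztt zx zxt zxx by fact
  note cD' = subsetD[OF closure_mono[OF assms(3)]]
  note J' = subsetD[OF assms(4)] subsetD[OF interior_mono[OF assms(4)]]
  have sub: "closure D' \<times> J' \<subseteq> closure D \<times> J" "D' \<times> interior J' \<subseteq> D \<times> interior J"
    using assms(3) cD' J' by auto
  show ?thesis
  proof (unfold_locales, goal_cases)
    case (2 x t)
    then show ?case using has_field_derivative_subset[OF z_t assms(4)] cD' J'(1) by blast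
  qed (use assms(2,3) J' z_x zt_t zt_x zx_t zx_x wave in
       \<open>auto intro: continuous_on_subset[OF _ sub(1)] continuous_on_subset[OF _ sub(2)]
          cont_z cont_zt cont_zx cont_ztt cont_zxt cont_zxx\<close>)
qed

lemma wave_jet_diff:
  assumes "wave_jet D J z zt ztt zx zxt zxx" "wave_jet D J z' zt' ztt' zx' zxt' zxx'"
  shows "wave_jet D J (\<lambda>x t. z x t - z' x t) (\<lambda>x t. zt x t - zt' x t) (\<lambda>x t. ztt x t - ztt' x t)
     (\<lambda>x t. zx x t - zx' x t) (\<lambda>x t. zxt x t - zxt' x t) (\<lambda>x t. zxx x t - zxx' x t)"
proof -
  interpret A: wave_jet D J z zt ztt zx zxt zxx by fact
  interpret B: wave_jet D J z' zt' ztt' zx' zxt' zxx' by fact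
  have wave: "ztt x t - ztt' x t = (\<Sum>i\<in>UNIV. zxx x t $ i - zxx' x t $ i)"
    if "x \<in> D" "t \<in> interior J" for x t
    using that by (simp add: A.wave B.wave sum_subtractf)
  show ?thesis
    by unfold_locales
       (auto intro!: A.open_D DERIV_diff continuous_on_diff wave simp:
         A.z_t B.z_t A.z_x B.z_x A.zt_t B.zt_t A.zt_x B.zt_x A.zx_t B.zx_t A.zx_x B.zx_x
         A.cont_z A.cont_zt A.cont_zx A.cont_ztt A.cont_zxt A.cont_zxx
         B.cont_z B.cont_zt B.cont_zx B.cont_ztt B.cont_zxt B.cont_zxx)
qed

text \<open>Reduces the backward Cauchy problem to uniqueness forward in time. Exactly the
  quantities with an odd number of time derivatives change sign.\<close>

lemma wave_jet_time_reversal: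
  assumes "wave_jet D {0..T} z zt ztt zx zxt zxx"
  shows "wave_jet D {0..T} (\<lambda>x t. z x (T - t)) (\<lambda>x t. - zt x (T - t)) (\<lambda>x t. ztt x (T - t))
     (\<lambda>x t. zx x (T - t)) (\<lambda>x t. - zxt x (T - t)) (\<lambda>x t. zxx x (T - t))"
proof -
  interpret wave_jet D "{0..T}" z zt ztt zx zxt zxx by fact
  have flip: "((\<lambda>s. f (T - s)) has_real_derivative - d) (at t within {0..T})"
    if "(f has_real_derivative d) (at (T - t) within {0..T})" for f d t
  proof -
    have "(\<lambda>s. T - s) ` {0..T} = {0..T}" by (auto simp: image_iff intro: bexI[of _ "T - _"])
    with that have "(f has_real_derivative d) (at (T - t) within (\<lambda>s. T - s) ` {0..T})" by simp
    moreover have "((\<lambda>s. T - s) has_real_derivative - 1) (at t within {0..T})"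
      by (auto intro!: derivative_eq_intros)
    ultimately show ?thesis using DERIV_image_chain by (fastforce simp: o_def)
  qed
  have flip': "((\<lambda>s. f (T - s)) has_real_derivative - d) (at t)"
    if "(f has_real_derivative d) (at (T - t))" for f d t
  proof -
    have "((\<lambda>s. T - s) has_real_derivative - 1) (at t)" by (auto intro!: derivative_eq_intros)
    from DERIV_chain2[where f = f and g = "\<lambda>s. T - s", OF that this] show ?thesis by simp
  qed
  have cont: "continuous_on (S \<times> I) (\<lambda>p. f (fst p) (T - snd p))"
    if "continuous_on (S \<times> I) (\<lambda>p. f (fst p) (snd p))" "\<And>t. t \<in> I \<Longrightarrow> T - t \<in> I"
    for S I and f :: "real^3 \<Rightarrow> real \<Rightarrow> 'b::topological_space"
  proof -
    have "continuous_on (S \<times> I) (\<lambda>p. (fst p, T - snd p))" by (intro continuous_intros)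
    then have "continuous_on (S \<times> I) (\<lambda>p. (\<lambda>p. f (fst p) (snd p)) (fst p, T - snd p))"
      by (rule continuous_on_compose2[OF that(1)]) (use that(2) in auto)
    then show ?thesis by simp
  qed
  have int: "interior {0..T} = {0<..<T}" by simp
  show ?thesis
  proof (unfold_locales, goal_cases)
    case 1 show ?case by (rule open_D)
  next
    case (2 x t) then show ?case by (intro flip z_t) auto
  next
    case (3 x t i) then show ?case by (intro z_x) auto
  next
    case (4 x t)
    then have "((\<lambda>t. zt x (T - t)) has_real_derivative - ztt x (T - t)) (at t)"
      by (intro flip' zt_t) auto
    from DERIV_minus[OF this] show ?case by simp
  next
    case (5 x t i)
    then have "((\<lambda>s. zt (x + s *\<^sub>R axis i 1) (T - t)) has_real_derivative zxt x (T - t) $ i) (at 0)"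
      by (intro zt_x) auto
    from DERIV_minus[OF this] show ?case by simp
  next
    case (6 x t i)
    then have "((\<lambda>t. zx x (T - t) $ i) has_real_derivative - (zxt x (T - t) $ i)) (at t)"
      by (intro flip'[of "\<lambda>t. zx x t $ i"] zx_t) auto
    then show ?case by simp
  next
    case (7 x t i) then show ?case by (intro zx_x) auto
  next
    case (8 x t) then show ?case by (intro wave) auto
  next
    case 9 show ?case by (intro cont cont_z) auto
  next
    case 10 show ?case by (intro continuous_on_minus cont cont_zt) auto
  next
    case 11 show ?case by (intro cont cont_zx) auto
  next
    case 12 show ?case by (intro cont cont_ztt) auto
  next
    case 13 show ?case by (intro continuous_on_minus cont cont_zxt) auto
  next
    case 14 show ?case by (intro cont cont_zxx) auto
  qed
qed

section \<open>Energy estimates and uniqueness\<close>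

lemma has_real_derivative_max_0_power2:
  "((\<lambda>x. (max 0 x)\<^sup>2) has_real_derivative 2 * max 0 x) (at (x::real))"
proof (cases x "0::real" rule: linorder_cases)
  case less
  have "((\<lambda>x. (max 0 x)\<^sup>2) has_real_derivative 0) (at x)"
    by (rule has_field_derivative_transform_within_open[OF DERIV_const, of "{..<0}"])
       (use less in auto)
  with less show ?thesis by simp
next
  case greater
  have "((\<lambda>x. x\<^sup>2) has_real_derivative 2 * x) (at x)" by (auto intro!: derivative_eq_intros)
  then have "((\<lambda>x. (max 0 x)\<^sup>2) has_real_derivative 2 * x) (at x)"
    by (rule has_field_derivative_transform_within_open[of _ _ _ "{0<..}"]) (use greater in auto)
  with greater show ?thesis by simp
next
  case equal
  have "((\<lambda>h. (max 0 h)\<^sup>2 / h) \<longlongrightarrow> 0) (at (0::real))"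
  proof (rule Lim_null_comparison)
    show "\<forall>\<^sub>F h in at 0. norm ((max 0 h)\<^sup>2 / h) \<le> \<bar>h::real\<bar>"
      by (intro always_eventually) (auto simp: max_def power2_eq_square)
    show "((\<lambda>h. \<bar>h::real\<bar>) \<longlongrightarrow> 0) (at 0)" by (intro tendsto_rabs_zero tendsto_ident_at)
  qed
  with equal show ?thesis by (simp add: DERIV_def)
qed

text \<open>The weight is the square of this function: the gap has a kink on the cone, its square is
  continuously differentiable. The polynomial is positive again after time \<open>R\<close>, whence
  the condition t \<le> R in the support lemmas.\<close>

definition cone_gap :: "real^3 \<Rightarrow> real \<Rightarrow> real^3 \<Rightarrow> real \<Rightarrow> real" where
  "cone_gap y R x t = max 0 ((R - t)\<^sup>2 - (norm (x - y))\<^sup>2)"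

lemma cone_gap_nonneg [simp]: "0 \<le> cone_gap y R x t"
  by (simp add: cone_gap_def)

lemma cone_gap_pos_iff:
  assumes "t \<le> R" shows "0 < cone_gap y R x t \<longleftrightarrow> norm (x - y) + t < R"
proof -
  have "0 < cone_gap y R x t \<longleftrightarrow> (norm (x - y))\<^sup>2 < (R - t)\<^sup>2"
    by (simp add: cone_gap_def less_max_iff_disj)
  also have "\<dots> \<longleftrightarrow> norm (x - y) < R - t"
    using assms by (auto intro: power2_less_imp_less power_strict_mono)
  finally show ?thesis by auto
qed

lemma cone_gap_eq_0:
  assumes "t \<le> R" "R \<le> norm (x - y) + t" shows "cone_gap y R x t = 0"
  using cone_gap_pos_iff[OF assms(1), of y x] assms(2) cone_gap_nonneg[of y R x t] by linarith

lemma continuous_cone_gap [continuous_intros]: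
  assumes "continuous_on S f" "continuous_on S g"
  shows "continuous_on S (\<lambda>p. cone_gap y R (f p) (g p))"
  unfolding cone_gap_def by (intro continuous_intros assms)

lemma cone_gap_power2_deriv_t:
  "((\<lambda>t. (cone_gap y R x t)\<^sup>2) has_real_derivative - 4 * (R - t) * cone_gap y R x t) (at t)"
  unfolding cone_gap_def
  by (rule DERIV_cong[OF DERIV_chain2[OF has_real_derivative_max_0_power2]])
     (auto intro!: derivative_eq_intros)

lemma norm_power2_deriv_axis:
  fixes x y :: "real^'n"
  shows "((\<lambda>s. (norm (x + s *\<^sub>R axis i 1 - y))\<^sup>2) has_real_derivative 2 * (x - y) $ i) (at 0)"
proof -
  have "(norm (x + s *\<^sub>R axis i 1 - y))\<^sup>2 = (norm (x - y))\<^sup>2 + 2 * s * (x - y) $ i + s\<^sup>2" for s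
  proof -
    have *: "x + s *\<^sub>R axis i 1 - y = (x - y) + s *\<^sub>R axis i 1" by simp
    have "axis i (1::real) \<bullet> axis i 1 = 1" by (simp add: inner_axis)
    then show ?thesis
      unfolding * power2_norm_eq_inner
      by (simp add: inner_add_left inner_add_right inner_axis inner_commute[of "axis i 1"]
          power2_eq_square algebra_simps)
  qed
  then show ?thesis by (auto intro!: derivative_eq_intros)
qed

lemma cone_gap_power2_deriv_x:
  "((\<lambda>s. (cone_gap y R (x + s *\<^sub>R axis i 1) t)\<^sup>2) has_real_derivative
     - 4 * cone_gap y R x t * (x - y) $ i) (at 0)"
  unfolding cone_gap_def
  by (rule DERIV_cong[OF DERIV_chain2[OF has_real_derivative_max_0_power2
        DERIV_diff[OF DERIV_const norm_power2_deriv_axis]]])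
     (simp add: algebra_simps)

text \<open>With \<open>e\<close> the weighted energy density and \<open>F\<close> its flux, the
  wave equation cancels the second derivatives in \<open>e' - div F\<close>. What the cone weight
  contributes is nonpositive, since |x - y| \<le> R - t wherever the weight is positive; what the
  gradient of \<eta> contributes is at most \<open>Q\<close>, whose integral is at most
  \<open>2 * M\<close>.\<close>

lemma (in wave_jet) energy_estimate:
  fixes \<eta> :: "real^3 \<Rightarrow> real" and g\<eta> :: "real^3 \<Rightarrow> real^3"
  assumes J: "J = {0..\<tau>}" "\<tau> \<le> R"
    and init: "\<And>x. x \<in> D \<Longrightarrow> norm (x - y) < R \<Longrightarrow> zt x 0 = 0 \<and> zx x 0 = 0"
    and \<eta>_x: "\<And>x i. ((\<lambda>s. \<eta> (x + s *\<^sub>R axis i 1)) has_real_derivative g\<eta> x $ i) (at 0)"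
    and cont_\<eta>: "continuous_on UNIV \<eta>" "continuous_on UNIV g\<eta>"
    and \<eta>_nonneg: "\<And>x. 0 \<le> \<eta> x"
    and K: "closed K" "K \<subseteq> D" "\<And>x. x \<notin> K \<Longrightarrow> \<eta> x = 0"
    and box: "cball y R \<subseteq> cbox a b"
    and flux: "\<And>t. 0 < t \<Longrightarrow> t < \<tau> \<Longrightarrow> integral (cbox a b)
      (\<lambda>x. (cone_gap y R x t)\<^sup>2 * (norm (g\<eta> x) * (norm (zx x t) * \<bar>zt x t\<bar>))) \<le> M"
    and t: "0 < t" "t < \<tau>"
  shows "integral (cbox a b)
    (\<lambda>x. \<eta> x * (cone_gap y R x t)\<^sup>2 * ((zt x t)\<^sup>2 + (norm (zx x t))\<^sup>2)) \<le> 2 * M * t"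
proof -
  have intJ: "interior J = {0<..<\<tau>}" by (simp add: J)
  define G where "G x r = cone_gap y R x r" for x r
  define e where "e r x = \<eta> x * (G x r)\<^sup>2 * ((zt x r)\<^sup>2 + zx x r \<bullet> zx x r)" for r x
  define e' where "e' r x = \<eta> x *
      (- 4 * (R - r) * G x r * ((zt x r)\<^sup>2 + zx x r \<bullet> zx x r)
       + (G x r)\<^sup>2 * (2 * zt x r * ztt x r + 2 * (zx x r \<bullet> zxt x r)))" for r x
  define F where "F r i x = 2 * \<eta> x * (G x r)\<^sup>2 * zt x r * zx x r $ i" for r i x
  define F' where "F' r i x = 2 * (g\<eta> x $ i * (G x r)\<^sup>2 + \<eta> x * (- 4 * G x r * (x - y) $ i)) * zt x r * zx x r $ i
      + 2 * \<eta> x * (G x r)\<^sup>2 * (zxt x r $ i * zx x r $ i + zt x r * zxx x r $ i)" for r i x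
  define Q where "Q r x = 2 * ((G x r)\<^sup>2 * (norm (g\<eta> x) * (norm (zx x r) * \<bar>zt x r\<bar>)))" for r x
  have g\<eta>_0: "g\<eta> x = 0" if "x \<notin> K" for x
    using DERIV_unique[OF \<eta>_x has_directional_derivative_zero_outside[OF K(1,3) that]]
    by (simp add: vec_eq_iff)
  have G0: "G x r = 0" if "x \<notin> cbox a b" "0 \<le> r" "r \<le> \<tau>" for x r
  proof -
    have "\<not> norm (x - y) \<le> R" using that box by (auto simp: dist_norm norm_minus_commute subset_iff)
    then show ?thesis unfolding G_def using that J by (intro cone_gap_eq_0) auto
  qed
  have cG: "continuous_on S (\<lambda>p. G (f p) (g p))"
    if "continuous_on S f" "continuous_on S g" for S :: "'z::topological_space set" and f g
    unfolding G_def by (intro continuous_intros that)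
  have c1: "continuous_on S (\<lambda>p. f (snd p) (fst p))"
    if "continuous_on (closure D \<times> J) (\<lambda>p. f (fst p) (snd p))" "S \<subseteq> {0..\<tau>} \<times> D"
    for S and f :: "real^3 \<Rightarrow> real \<Rightarrow> 'z::topological_space"
  proof -
    have "continuous_on S (\<lambda>p. (\<lambda>p. f (fst p) (snd p)) (snd p, fst p))"
      using that(2) closure_subset[of D]
      by (intro continuous_on_compose2[OF that(1)] continuous_intros) (auto simp: J)
    then show ?thesis by simp
  qed
  have c2: "continuous_on S (\<lambda>p. f (snd p) (fst p))"
    if "continuous_on (D \<times> interior J) (\<lambda>p. f (fst p) (snd p))" "S \<subseteq> {0<..<\<tau>} \<times> D"
    for S and f :: "real^3 \<Rightarrow> real \<Rightarrow> 'z::topological_space"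
  proof -
    have "continuous_on S (\<lambda>p. (\<lambda>p. f (fst p) (snd p)) (snd p, fst p))"
      using that(2)
      by (intro continuous_on_compose2[OF that(1)] continuous_intros) (auto simp: intJ)
    then show ?thesis by simp
  qed
  note c\<eta> = continuous_on_compose2[OF cont_\<eta>(1)] continuous_on_compose2[OF cont_\<eta>(2)]
  \<comment> \<open>On the first set the integrands are continuous; on the second they vanish,
    whatever values the derivatives of \<open>z\<close> take outside \<open>D\<close>.\<close>
  have oDK: "open (UNIV \<times> D :: (real \<times> _) set)" "open (UNIV \<times> - K :: (real \<times> _) set)"
    using open_D K(1) by (auto intro: open_Times)
  have pair: "continuous_on S (\<lambda>p. f (fst p) (snd p))"
    if "continuous_on (S \<inter> UNIV \<times> D) (\<lambda>p. f (fst p) (snd p))"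
       "\<And>r x. x \<notin> K \<Longrightarrow> f r x = 0" for S and f :: "real \<Rightarrow> real^3 \<Rightarrow> real"
    by (rule continuous_on_zero_extension[OF oDK _ that(1)]) (use K(2) that(2) in auto)
  have ce: "continuous_on ({0..\<tau>} \<times> UNIV) (\<lambda>p. e (fst p) (snd p))"
    by (rule pair, unfold e_def)
       (auto simp: K(3) intro!: continuous_intros cG c\<eta> c1[OF cont_zt] c1[OF cont_zx])
  have ce': "continuous_on ({0<..<\<tau>} \<times> UNIV) (\<lambda>p. e' (fst p) (snd p))"
    by (rule pair, unfold e'_def)
       (auto simp: K(3) intro!: continuous_intros cG c\<eta> c1[OF cont_zt] c1[OF cont_zx]
          c2[OF cont_ztt] c2[OF cont_zxt])
  have cF: "continuous_on ({0..\<tau>} \<times> UNIV) (\<lambda>p. F (fst p) i (snd p))" for i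
    by (rule pair[of _ "\<lambda>r x. F r i x"], unfold F_def)
       (auto simp: K(3) intro!: continuous_intros cG c\<eta> c1[OF cont_zt] c1[OF cont_zx])
  have cF': "continuous_on ({0<..<\<tau>} \<times> UNIV) (\<lambda>p. F' (fst p) i (snd p))" for i
    by (rule pair[of _ "\<lambda>r x. F' r i x"], unfold F'_def)
       (auto simp: K(3) g\<eta>_0 intro!: continuous_intros cG c\<eta> c1[OF cont_zt] c1[OF cont_zx]
          c2[OF cont_zxt] c2[OF cont_zxx])
  have cQ: "continuous_on ({0..\<tau>} \<times> UNIV) (\<lambda>p. Q (fst p) (snd p))"
    by (rule pair, unfold Q_def)
       (auto simp: g\<eta>_0 intro!: continuous_intros cG c\<eta> c1[OF cont_zt] c1[OF cont_zx])
  have slice: "continuous_on S (f r)" if "continuous_on (I \<times> UNIV) (\<lambda>p. f (fst p) (snd p))" "r \<in> I"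
    for S I r and f :: "real \<Rightarrow> real^3 \<Rightarrow> real"
  proof -
    have "continuous_on S (\<lambda>x. (\<lambda>p. f (fst p) (snd p)) (r, x))"
      by (rule continuous_on_compose2[OF that(1)]) (use that(2) in \<open>auto intro!: continuous_intros\<close>)
    then show ?thesis by simp
  qed
  have e_t: "((\<lambda>r. e r x) has_real_derivative e' r x) (at r)" if "r \<in> {0<..<\<tau>}" for r x
  proof (cases "x \<in> K")
    case True
    then have "x \<in> D" "r \<in> interior J" using K(2) that intJ by auto
    note d = zt_t[OF this] zx_t[OF this]
    have dot: "((\<lambda>r. zx x r \<bullet> zx x r) has_real_derivative 2 * (zx x r \<bullet> zxt x r)) (at r)"
      unfolding inner_vec_def inner_real_def
      by (rule DERIV_cong[OF DERIV_sum[OF DERIV_mult[OF d(2) d(2)]]])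
         (simp add: sum_distrib_left algebra_simps)
    show ?thesis unfolding e_def e'_def G_def
      by (rule DERIV_cong, (rule derivative_intros d dot cone_gap_power2_deriv_t)+)
         (simp add: algebra_simps)
  next
    case False
    then show ?thesis by (simp add: e_def e'_def K(3))
  qed
  have F_x: "((\<lambda>s. F r i (x + s *\<^sub>R axis i 1)) has_real_derivative F' r i x) (at 0)"
    if "r \<in> {0<..<\<tau>}" for r i x
  proof (cases "x \<in> K")
    case True
    then have "x \<in> D" "r \<in> interior J" using K(2) that intJ by auto
    note d = zt_x[OF this] zx_x[OF this]
    show ?thesis unfolding F_def F'_def G_def
      by (rule DERIV_cong, (rule derivative_intros d \<eta>_x cone_gap_power2_deriv_x)+)
         (simp add: algebra_simps)
  next
    case False
    then have "F' r i x = 0" by (simp add: F'_def K(3) g\<eta>_0)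
    moreover have "((\<lambda>s. F r i (x + s *\<^sub>R axis i 1)) has_real_derivative 0) (at 0)"
      by (rule has_directional_derivative_zero_outside[OF K(1) _ False]) (simp add: F_def K(3))
    ultimately show ?thesis by simp
  qed
  have F'_int: "integral (cbox a b) (F' r i) = 0" if "r \<in> {0<..<\<tau>}" for r i
  proof (rule integral_directional_derivative_eq_0[OF F_x[OF that]])
    show "continuous_on UNIV (F r i)" using slice[OF cF] that by simp
    show "continuous_on UNIV (F' r i)" using slice[OF cF' that] .
    show "F r i x = 0" if "x \<notin> cbox a b" for x
      using G0[OF that] \<open>r \<in> _\<close> by (simp add: F_def)
  qed
  have pointwise: "e' r x - (\<Sum>i\<in>UNIV. F' r i x) \<le> Q r x" if r: "r \<in> {0<..<\<tau>}" for r x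
  proof (cases "x \<in> K")
    case False
    then show ?thesis by (simp add: e'_def F'_def Q_def K(3) g\<eta>_0)
  next
    case True
    then have xr: "x \<in> D" "r \<in> interior J" using K(2) that intJ by auto
    let ?g = "G x r" and ?zt = "zt x r" and ?zx = "zx x r"
    have "(\<Sum>i\<in>UNIV. F' r i x) = 2 * ?g\<^sup>2 * ?zt * (g\<eta> x \<bullet> ?zx) - 8 * \<eta> x * ?g * ?zt * ((x - y) \<bullet> ?zx)
        + 2 * \<eta> x * ?g\<^sup>2 * (zxt x r \<bullet> ?zx + ?zt * ztt x r)"
      unfolding F'_def inner_vec_def inner_real_def wave[OF xr]
      by (simp add: sum.distrib sum_subtractf sum_distrib_left sum_distrib_right algebra_simps)
    then have eq: "e' r x - (\<Sum>i\<in>UNIV. F' r i x) =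
        4 * \<eta> x * (?g * (2 * ?zt * ((x - y) \<bullet> ?zx) - (R - r) * (?zt\<^sup>2 + ?zx \<bullet> ?zx)))
        + 2 * (?g\<^sup>2 * - (?zt * (g\<eta> x \<bullet> ?zx)))"
      by (simp add: e'_def inner_commute algebra_simps)
    have "?g * (2 * ?zt * ((x - y) \<bullet> ?zx) - (R - r) * (?zt\<^sup>2 + ?zx \<bullet> ?zx)) \<le> 0"
    proof (cases "?g > 0")
      case False
      then have "?g = 0" using cone_gap_nonneg[of y R x r] by (simp add: G_def)
      then show ?thesis by simp
    next
      case True
      then have xy: "norm (x - y) \<le> R - r"
        using cone_gap_pos_iff[of r R y x] r J by (simp add: G_def)
      have "2 * ?zt * ((x - y) \<bullet> ?zx) \<le> 2 * \<bar>?zt\<bar> * (norm (x - y) * norm ?zx)"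
      proof -
        have "?zt * ((x - y) \<bullet> ?zx) \<le> \<bar>?zt\<bar> * \<bar>(x - y) \<bullet> ?zx\<bar>"
          using abs_ge_self[of "?zt * ((x - y) \<bullet> ?zx)"] by (simp add: abs_mult)
        also have "\<dots> \<le> \<bar>?zt\<bar> * (norm (x - y) * norm ?zx)"
          by (intro mult_left_mono Cauchy_Schwarz_ineq2) simp
        finally show ?thesis by simp
      qed
      also have "\<dots> \<le> norm (x - y) * (?zt\<^sup>2 + (norm ?zx)\<^sup>2)"
      proof -
        have "2 * \<bar>?zt\<bar> * norm ?zx \<le> \<bar>?zt\<bar>\<^sup>2 + (norm ?zx)\<^sup>2" by (rule sum_squares_bound)
        from mult_left_mono[OF this norm_ge_zero[of "x - y"]] show ?thesis by (simp add: algebra_simps)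
      qed
      also have "\<dots> \<le> (R - r) * (?zt\<^sup>2 + (norm ?zx)\<^sup>2)"
        by (intro mult_right_mono xy) simp
      finally show ?thesis
        using True by (intro mult_nonneg_nonpos) (auto simp: power2_norm_eq_inner)
    qed
    then have 1: "4 * \<eta> x * (?g * (2 * ?zt * ((x - y) \<bullet> ?zx) - (R - r) * (?zt\<^sup>2 + ?zx \<bullet> ?zx))) \<le> 0"
      using \<eta>_nonneg[of x] by (intro mult_nonneg_nonpos[of "4 * \<eta> x"]) auto
    have "- (?zt * (g\<eta> x \<bullet> ?zx)) \<le> \<bar>?zt\<bar> * (norm (g\<eta> x) * norm ?zx)"
      using mult_left_mono[OF Cauchy_Schwarz_ineq2[of "g\<eta> x" ?zx] abs_ge_zero[of ?zt]]
        abs_ge_minus_self[of "?zt * (g\<eta> x \<bullet> ?zx)"] unfolding abs_mult by linarith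
    then have "?g\<^sup>2 * - (?zt * (g\<eta> x \<bullet> ?zx)) \<le> ?g\<^sup>2 * (\<bar>?zt\<bar> * (norm (g\<eta> x) * norm ?zx))"
      by (rule mult_left_mono) simp
    then have "2 * (?g\<^sup>2 * - (?zt * (g\<eta> x \<bullet> ?zx))) \<le> Q r x"
      unfolding Q_def by (simp add: mult.left_commute mult.commute)
    with 1 eq show ?thesis by linarith
  qed
  define E where "E r = integral (cbox a b) (e r)" for r
  have E_t: "(E has_real_derivative integral (cbox a b) (e' r)) (at r)" if r: "r \<in> {0<..<\<tau>}" for r
  proof -
    have "(E has_real_derivative integral (cbox a b) (e' r)) (at r within {0<..<\<tau>})"
      unfolding E_def
    proof (rule leibniz_rule_field_derivative[OF _ _ _ r])
      show "((\<lambda>r. e r x) has_real_derivative e' r x) (at r within {0<..<\<tau>})" if "r \<in> {0<..<\<tau>}" for r x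
        using e_t[OF that] by (rule has_field_derivative_at_within)
      show "e r integrable_on cbox a b" if "r \<in> {0<..<\<tau>}" for r
        using slice[OF ce, of r "cbox a b"] that by (intro integrable_continuous) auto
      show "continuous_on ({0<..<\<tau>} \<times> cbox a b) (\<lambda>(r, x). e' r x)"
        unfolding case_prod_unfold by (rule continuous_on_subset[OF ce']) auto
    qed auto
    with r show ?thesis by (simp add: at_within_open[of r "{0<..<\<tau>}"])
  qed
  have E'_le: "integral (cbox a b) (e' r) \<le> 2 * M" if r: "r \<in> {0<..<\<tau>}" for r
  proof -
    have ie: "e' r integrable_on cbox a b" and iF: "\<And>i. F' r i integrable_on cbox a b"
      and iQ: "Q r integrable_on cbox a b"
      using slice[OF ce' r] slice[OF cF' r] slice[OF cQ, of r] r by (auto intro!: integrable_continuous)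
    have "integral (cbox a b) (\<lambda>x. e' r x - (\<Sum>i\<in>UNIV. F' r i x))
        = integral (cbox a b) (e' r) - (\<Sum>i\<in>UNIV. integral (cbox a b) (F' r i))"
      by (subst integral_diff) (auto intro!: integrable_sum ie iF simp: integral_sum iF)
    also have "\<dots> = integral (cbox a b) (e' r)" using F'_int[OF r] by simp
    finally have "integral (cbox a b) (e' r) = integral (cbox a b) (\<lambda>x. e' r x - (\<Sum>i\<in>UNIV. F' r i x))"
      by (rule sym)
    also have "\<dots> \<le> integral (cbox a b) (Q r)"
      by (intro integral_le integrable_diff integrable_sum ie iF iQ pointwise[OF r]) auto
    also have "\<dots> \<le> 2 * M"
      using flux[of r] r unfolding Q_def G_def by simp
    finally show ?thesis .
  qed
  have "continuous_on {0..\<tau>} E"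
    unfolding E_def
    by (rule integral_continuous_on_param)
       (auto simp: case_prod_unfold intro: continuous_on_subset[OF ce])
  then have cE: "continuous_on {0..t} E" by (rule continuous_on_subset) (use t in auto)
  have "E 0 = 0"
  proof -
    have "e 0 x = 0" for x
    proof (cases "x \<in> K \<and> norm (x - y) < R")
      case True then show ?thesis using init[of x] K(2) by (auto simp: e_def)
    next
      case False
      then have "\<eta> x = 0 \<or> G x 0 = 0"
        using K(3)[of x] cone_gap_eq_0[of 0 R x y] J t by (auto simp: G_def)
      then show ?thesis by (auto simp: e_def)
    qed
    then have "e 0 = (\<lambda>_. 0)" by auto
    then show ?thesis by (simp add: E_def)
  qed
  \<comment> \<open>The energy is known to be differentiable only at interior times, but it is
    continuous at 0, which is enough for the mean value theorem.\<close>
  moreover obtain r where r: "0 < r" "r < t" "E t - E 0 = t * integral (cbox a b) (e' r)"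
  proof -
    have dE: "(E has_real_derivative integral (cbox a b) (e' s)) (at s)" if "0 < s" "s < t" for s
      using E_t that t by auto
    then have "\<exists>l r. 0 < r \<and> r < t \<and> (E has_real_derivative l) (at r) \<and> E t - E 0 = (t - 0) * l"
      by (intro MVT t cE) (auto simp: real_differentiable_def)
    then show thesis using DERIV_unique[OF dE] that by (metis diff_zero)
  qed
  ultimately have "E t \<le> t * (2 * M)"
    using E'_le[of r] t by (simp add: mult_left_mono)
  then show ?thesis by (simp add: E_def e_def[abs_def] G_def power2_norm_eq_inner mult_ac)
qed

section \<open>From vanishing energy to a vanishing solution\<close>

lemma (in wave_jet) spatial_gradient_initial:
  assumes "open W" "W \<subseteq> D" "\<And>x. x \<in> W \<Longrightarrow> z x t = 0" "x \<in> W" "t \<in> J"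
  shows "zx x t = 0"
proof -
  have "zx x t $ i = 0" for i
    using assms
    by (intro DERIV_unique[OF z_x has_directional_derivative_zero_outside[where K = "- W"]]) auto
  then show ?thesis by (simp add: vec_eq_iff)
qed

lemma (in wave_jet) eq_0_of_time_deriv_eq_0:
  assumes J: "J = {0..\<tau>}" and x: "x \<in> D" "z x 0 = 0" and t: "0 \<le> t" "t \<le> \<tau>"
    and zt: "\<And>s. 0 < s \<Longrightarrow> s < t \<Longrightarrow> zt x s = 0"
  shows "z x t = 0"
proof (cases "t = 0")
  case False
  have d: "(z x has_real_derivative zt x s) (at s within {0..\<tau>})" if "s \<in> {0..\<tau>}" for s
    using z_t[of x s] that x closure_subset[of D] by (auto simp: J)
  then have "continuous_on {0..\<tau>} (z x)" by (rule DERIV_continuous_on)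
  then have cont: "continuous_on {0..t} (z x)" by (rule continuous_on_subset) (use t in auto)
  have "z x t = z x 0"
  proof (rule DERIV_isconst_end[where f = "z x"])
    show "0 < t" using False t by simp
    show "continuous_on {0..t} (z x)" by (rule cont)
    show "(z x has_real_derivative 0) (at s)" if "0 < s" "s < t" for s
      using d[of s] zt[of s] that t at_within_interior[of s "{0..\<tau>}"] by simp
  qed
  with x show ?thesis by simp
qed (use x in simp)

text \<open>A continuous nonnegative integrand without positive integral is 0 at every point of a
  nondegenerate box; at points where both weights are positive they can be divided out.\<close>

lemma (in wave_jet) time_deriv_eq_0_of_energy:
  assumes J: "J = {0..\<tau>}"
    and cont_\<eta>: "continuous_on UNIV \<eta>" and \<eta>_nonneg: "\<And>x. 0 \<le> \<eta> x"
    and K: "closed K" "K \<subseteq> D" "\<And>x. x \<notin> K \<Longrightarrow> \<eta> x = 0"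
    and t: "0 \<le> t" "t \<le> \<tau>"
    and energy: "integral (cbox a b)
      (\<lambda>x. \<eta> x * (cone_gap y R x t)\<^sup>2 * ((zt x t)\<^sup>2 + (norm (zx x t))\<^sup>2)) \<le> 0"
    and x: "x \<in> cbox a b" "box a b \<noteq> {}" "0 < \<eta> x" "0 < cone_gap y R x t"
  shows "zt x t = 0"
proof -
  define f where "f x = \<eta> x * (cone_gap y R x t)\<^sup>2 * ((zt x t)\<^sup>2 + (norm (zx x t))\<^sup>2)" for x
  have slice: "continuous_on (cbox a b \<inter> D) (\<lambda>x. g x t)"
    if "continuous_on (closure D \<times> J) (\<lambda>p. g (fst p) (snd p))"
    for g :: "real^3 \<Rightarrow> real \<Rightarrow> 'z::topological_space"
  proof -
    have "continuous_on (cbox a b \<inter> D) (\<lambda>x. (\<lambda>p. g (fst p) (snd p)) (x, t))"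
      by (rule continuous_on_compose2[OF that])
         (use closure_subset[of D] t J in \<open>auto intro!: continuous_intros\<close>)
    then show ?thesis by simp
  qed
  have "continuous_on (cbox a b) f"
  proof (rule continuous_on_zero_extension[of D "- K"])
    show "continuous_on (cbox a b \<inter> D) f"
      unfolding f_def
      by (intro continuous_intros slice[OF cont_zt] slice[OF cont_zx]
          continuous_on_subset[OF cont_\<eta>]) auto
  qed (use K open_D in \<open>auto simp: f_def\<close>)
  moreover have nn: "0 \<le> f x" for x using \<eta>_nonneg[of x] by (auto simp: f_def)
  moreover have "integral (cbox a b) f = 0"
    using energy Henstock_Kurzweil_Integration.integral_nonneg[of f "cbox a b"] calculation
    by (simp add: f_def[abs_def] integrable_continuous)
  ultimately have "f x = 0" using integral_cbox_eq_0_iff[of a b f] x(1,2) by blast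
  then have "(zt x t)\<^sup>2 + (norm (zx x t))\<^sup>2 = 0" using x(3,4) by (simp add: f_def)
  then show ?thesis by (simp add: sum_power2_eq_zero_iff)
qed

text \<open>Without a boundary the cutoff is the constant 1 and the flux bound is 0. The segment
  from (x, 0) to (x, t) lies in the cone, so \<open>z\<close> starts at 0 and has zero time
  derivative along it.\<close>

lemma domain_of_dependence:
  assumes "wave_jet UNIV {0..\<tau>} z zt ztt zx zxt zxx" and R: "\<tau> \<le> R"
    and init: "\<And>x. norm (x - y) < R \<Longrightarrow> z x 0 = 0 \<and> zt x 0 = 0"
    and x: "norm (x - y) + t < R" and t: "0 \<le> t" "t \<le> \<tau>"
  shows "z x t = 0"
proof -
  interpret wave_jet UNIV "{0..\<tau>}" z zt ztt zx zxt zxx by fact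
  have init_zx: "zx x 0 = 0" if "norm (x - y) < R" for x
    using spatial_gradient_initial[of "ball y R" 0 x] init t that
    by (simp add: dist_norm norm_minus_commute)
  obtain c where c: "cball y R \<subseteq> box (- c) c"
    using bounded_subset_box_symmetric[OF bounded_cball[of y R]] by blast
  have "zt x s = 0" if s: "0 < s" "s < t" for s
  proof (rule time_deriv_eq_0_of_energy[of \<tau> "\<lambda>_. 1" UNIV s "- c" c y R])
    have "integral (cbox (- c) c)
      (\<lambda>x. 1 * (cone_gap y R x s)\<^sup>2 * ((zt x s)\<^sup>2 + (norm (zx x s))\<^sup>2)) \<le> 2 * 0 * s"
    proof (rule energy_estimate[where g\<eta> = "\<lambda>_. 0" and K = UNIV and \<tau> = \<tau>])
      show "cball y R \<subseteq> cbox (- c) c" using c box_subset_cbox by blast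
    qed (use R init init_zx s t in auto)
    then show "integral (cbox (- c) c)
      (\<lambda>x. 1 * (cone_gap y R x s)\<^sup>2 * ((zt x s)\<^sup>2 + (norm (zx x s))\<^sup>2)) \<le> 0" by simp
    have "x \<in> cball y R" using x t by (simp add: dist_norm norm_minus_commute)
    then show "x \<in> cbox (- c) c" "box (- c) c \<noteq> {}" using c box_subset_cbox by blast+
    show "0 < cone_gap y R x s" using x s t R by (subst cone_gap_pos_iff) auto
  qed (use s t in auto)
  note zt0 = this
  show ?thesis
    by (rule eq_0_of_time_deriv_eq_0[of \<tau>]) (use init[of x] x t zt0 in auto)
qed

section \<open>Cutoffs near the unit sphere\<close>

definition spline_step :: "real \<Rightarrow> real" where
  "spline_step s = 2 * ((max 0 s)\<^sup>2 - 2 * (max 0 (s - 1/2))\<^sup>2 + (max 0 (s - 1))\<^sup>2)"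

text \<open>The hat function on [0, 1] with peak 2 and area 1. Its primitive
  \<open>spline_step\<close> is a quadratic spline from 0 to 1 with one continuous derivative, as
  much as the energy estimate asks of a cutoff.\<close>

definition spline_hat :: "real \<Rightarrow> real" where
  "spline_hat s = 4 * (max 0 s - 2 * max 0 (s - 1/2) + max 0 (s - 1))"

lemma spline_step_deriv: "(spline_step has_real_derivative spline_hat s) (at s)"
proof -
  have d: "((\<lambda>s. (max 0 (s - c))\<^sup>2) has_real_derivative 2 * max 0 (s - c)) (at s)" for c
    using DERIV_shift[of "\<lambda>s. (max 0 s)\<^sup>2" "2 * max 0 (s - c)" s "- c"]
      has_real_derivative_max_0_power2[of "s - c"] by simp
  show ?thesis
    unfolding spline_step_def[abs_def] spline_hat_def
    by (rule DERIV_cong, (rule derivative_intros d[of 0, simplified] d)+) (simp add: algebra_simps)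
qed

lemma spline_hat_nonneg: "0 \<le> spline_hat s"
  by (auto simp: spline_hat_def max_def)

lemma spline_hat_eq_0: "s \<le> 0 \<or> 1 \<le> s \<Longrightarrow> spline_hat s = 0"
  by (auto simp: spline_hat_def max_def)

lemma spline_step_eq_0: "s \<le> 0 \<Longrightarrow> spline_step s = 0"
  by (auto simp: spline_step_def max_def)

lemma spline_step_eq_1: "1 \<le> s \<Longrightarrow> spline_step s = 1"
  by (auto simp: spline_step_def max_def power2_eq_square algebra_simps)

lemma spline_step_mono: "s \<le> t \<Longrightarrow> spline_step s \<le> spline_step t"
  using DERIV_nonneg_imp_nondecreasing spline_step_deriv spline_hat_nonneg by metis

lemma spline_step_nonneg: "0 \<le> spline_step s"
  using spline_step_mono[of "min 0 s" s] spline_step_eq_0[of "min 0 s"] by simp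

lemma spline_step_le_1: "spline_step s \<le> 1"
  using spline_step_mono[of s "max 1 s"] spline_step_eq_1[of "max 1 s"] by simp

lemma continuous_spline_hat: "continuous_on UNIV spline_hat"
  unfolding spline_hat_def[abs_def] by (intro continuous_intros)

lemma continuous_spline_step: "continuous_on UNIV spline_step"
  unfolding spline_step_def[abs_def] by (intro continuous_intros)

text \<open>The transition occupies 1 + \<delta> \<le> |x|^2 \<le> 1 + 2 \<delta>, so for \<delta> >
  0 the support keeps a positive distance from the closed ball. Using the squared norm makes the
  gradient a nonnegative multiple of \<open>x\<close>.\<close>

definition shell_cutoff :: "real \<Rightarrow> real^3 \<Rightarrow> real" where
  "shell_cutoff \<delta> x = spline_step (((norm x)\<^sup>2 - 1 - \<delta>) / \<delta>)"

definition shell_cutoff_grad :: "real \<Rightarrow> real^3 \<Rightarrow> real^3" where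
  "shell_cutoff_grad \<delta> x = (2 / \<delta> * spline_hat (((norm x)\<^sup>2 - 1 - \<delta>) / \<delta>)) *\<^sub>R x"

lemma shell_cutoff_deriv:
  assumes "0 < \<delta>"
  shows "((\<lambda>s. shell_cutoff \<delta> (x + s *\<^sub>R axis i 1)) has_real_derivative
    shell_cutoff_grad \<delta> x $ i) (at 0)"
proof -
  have "((\<lambda>s. (norm (x + s *\<^sub>R axis i 1))\<^sup>2) has_real_derivative 2 * x $ i) (at 0)"
    using norm_power2_deriv_axis[of x i 0] by simp
  from DERIV_cdivide[OF DERIV_diff[OF DERIV_diff[OF this DERIV_const] DERIV_const]]
  have "((\<lambda>s. ((norm (x + s *\<^sub>R axis i 1))\<^sup>2 - 1 - \<delta>) / \<delta>) has_real_derivative 2 * x $ i / \<delta>) (at 0)"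
    by simp
  from DERIV_chain2[OF spline_step_deriv this] show ?thesis
    by (simp add: shell_cutoff_def shell_cutoff_grad_def mult_ac)
qed

lemma continuous_shell_cutoff:
  assumes "0 < \<delta>"
  shows "continuous_on UNIV (shell_cutoff \<delta>)" "continuous_on UNIV (shell_cutoff_grad \<delta>)"
  unfolding shell_cutoff_def[abs_def] shell_cutoff_grad_def[abs_def]
  by (intro continuous_intros continuous_on_compose2[OF continuous_spline_step]
      continuous_on_compose2[OF continuous_spline_hat]; use assms in auto)+

text \<open>Allows the energy with a fixed cutoff to be bounded by energies whose transition shells
  shrink to the sphere.\<close>

lemma shell_cutoff_antimono:
  assumes "0 < \<delta>" "\<delta> \<le> \<delta>'"
  shows "shell_cutoff \<delta>' x \<le> shell_cutoff \<delta> x"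
proof (cases "1 \<le> (norm x)\<^sup>2")
  case True
  then have "((norm x)\<^sup>2 - 1) / \<delta>' \<le> ((norm x)\<^sup>2 - 1) / \<delta>"
    using assms by (intro divide_left_mono) auto
  then show ?thesis
    unfolding shell_cutoff_def using assms by (intro spline_step_mono) (simp add: diff_divide_distrib)
next
  case False
  then have "shell_cutoff \<delta>' x = 0"
    unfolding shell_cutoff_def using assms by (intro spline_step_eq_0) (simp add: divide_nonpos_pos)
  then show ?thesis by (simp add: shell_cutoff_def spline_step_nonneg)
qed

text \<open>
  The bound does not depend on \<open>\<delta>\<close>: \<open>x\<close> times the gradient of the cutoff dominates the length of that
  gradient, and an integration by parts moves the derivative off the cutoff.
\<close>

lemma shell_flux_bound:
  assumes \<delta>: "0 < \<delta>" and r: "0 \<le> r" "r \<le> R" and box: "cball 0 R \<subseteq> cbox a b"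
  shows "integral (cbox a b) (\<lambda>x. (cone_gap 0 R x r)\<^sup>2 * (shell_cutoff_grad \<delta> x \<bullet> x))
    \<le> 4 * R^4 * measure lborel (cbox a b)"
proof -
  let ?\<eta> = "shell_cutoff \<delta>" and ?g = "shell_cutoff_grad \<delta>" and ?P = "\<lambda>x. cone_gap 0 R x r"
  define F where "F i x = (?P x)\<^sup>2 * ?\<eta> x * x $ i" for i x
  define F' where "F' i x = - 4 * ?P x * x $ i * ?\<eta> x * x $ i + (?P x)\<^sup>2 * ?g x $ i * x $ i
      + (?P x)\<^sup>2 * ?\<eta> x" for i x
  note c = continuous_on_compose2[OF continuous_shell_cutoff(1)[OF \<delta>]]
    continuous_on_compose2[OF continuous_shell_cutoff(2)[OF \<delta>]]
  have cF': "continuous_on UNIV (F' i)" for i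
    unfolding F'_def[abs_def] by (intro continuous_intros c) auto
  have P0: "?P x = 0" if "R \<le> norm x" for x
    using that r by (intro cone_gap_eq_0) auto
  have "integral (cbox a b) (F' i) = 0" for i
  proof (rule integral_directional_derivative_eq_0)
    show "((\<lambda>s. F i (x + s *\<^sub>R axis i 1)) has_real_derivative F' i x) (at 0)" for x
    proof -
      have "((\<lambda>s. (x + s *\<^sub>R axis i 1) $ i) has_real_derivative 1) (at 0)"
        by (auto intro!: derivative_eq_intros)
      note d = DERIV_mult[OF DERIV_mult[OF cone_gap_power2_deriv_x shell_cutoff_deriv[OF \<delta>]] this]
      show ?thesis
        unfolding F_def F'_def by (rule DERIV_cong[OF d]) (simp add: algebra_simps)
    qed
    show "continuous_on UNIV (F i)" unfolding F_def by (intro continuous_intros c) auto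
    show "F i x = 0" if "x \<notin> cbox a b" for x
    proof -
      have "R \<le> norm x" using that box by (force simp: subset_iff not_le dist_norm intro: less_imp_le)
      then show ?thesis by (simp add: F_def P0)
    qed
  qed (rule cF')
  then have 0: "integral (cbox a b) (\<lambda>x. \<Sum>i\<in>UNIV. F' i x) = 0"
    by (subst integral_sum) (auto intro!: integrable_continuous continuous_on_subset[OF cF'])
  \<comment> \<open>The 3 is the divergence of \<open>x\<close>. The term carrying it has a
    favourable sign, so only the one with |x|^2 must be bounded, which yields
    \<open>4 * R^4\<close>.\<close>
  have sum: "(\<Sum>i\<in>UNIV. F' i x) = (?P x)\<^sup>2 * (?g x \<bullet> x) - ?\<eta> x * (4 * ?P x * (norm x)\<^sup>2 - 3 * (?P x)\<^sup>2)" for x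
    unfolding F'_def power2_norm_eq_inner inner_vec_def inner_real_def
    by (simp add: sum.distrib sum_subtractf sum_distrib_left sum_negf algebra_simps)
  have bound: "(?P x)\<^sup>2 * (?g x \<bullet> x) \<le> (\<Sum>i\<in>UNIV. F' i x) + 4 * R^4" for x
  proof -
    have "?\<eta> x * (4 * ?P x * (norm x)\<^sup>2 - 3 * (?P x)\<^sup>2) \<le> 1 * (4 * R\<^sup>2 * R\<^sup>2)"
    proof (cases "R \<le> norm x")
      case False
      have "?P x \<le> R\<^sup>2"
      proof -
        have "(R - r)\<^sup>2 \<le> R\<^sup>2" using r by (intro power_mono) auto
        then show ?thesis unfolding cone_gap_def by (auto intro: order_trans[of _ "(R - r)\<^sup>2"])
      qed
      moreover have "(norm x)\<^sup>2 \<le> R\<^sup>2" using False by (intro power_mono) auto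
      ultimately have "4 * ?P x * (norm x)\<^sup>2 \<le> 4 * R\<^sup>2 * R\<^sup>2" by (intro mult_mono) auto
      then have le: "4 * ?P x * (norm x)\<^sup>2 - 3 * (?P x)\<^sup>2 \<le> 4 * R\<^sup>2 * R\<^sup>2"
        using zero_le_power2[of "?P x"] by linarith
      have \<eta>: "0 \<le> ?\<eta> x" "?\<eta> x \<le> 1"
        by (simp_all add: shell_cutoff_def spline_step_nonneg spline_step_le_1)
      have "?\<eta> x * (4 * ?P x * (norm x)\<^sup>2 - 3 * (?P x)\<^sup>2) \<le> ?\<eta> x * (4 * R\<^sup>2 * R\<^sup>2)"
        using le \<eta>(1) by (rule mult_left_mono)
      also have "\<dots> \<le> 1 * (4 * R\<^sup>2 * R\<^sup>2)" using \<eta>(2) by (rule mult_right_mono) simp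
      finally show ?thesis .
    qed (simp add: P0)
    then show ?thesis unfolding sum by (simp add: power4_eq_xxxx power2_eq_square)
  qed
  have "integral (cbox a b) (\<lambda>x. (?P x)\<^sup>2 * (?g x \<bullet> x))
      \<le> integral (cbox a b) (\<lambda>x. (\<Sum>i\<in>UNIV. F' i x) + 4 * R^4)"
    by (intro integral_le bound integrable_continuous continuous_intros continuous_on_subset[OF cF'] c) auto
  also have "\<dots> = 4 * R^4 * measure lborel (cbox a b)"
    using 0 by (subst integral_add)
      (auto intro!: integrable_continuous continuous_intros continuous_on_subset[OF cF'])
  finally show ?thesis .
qed

text \<open>The gradient is radial and vanishes for |x| < 1; elsewhere |x| \<le> |x|^2.\<close>

lemma shell_cutoff_grad_norm:
  assumes "0 < \<delta>" shows "norm (shell_cutoff_grad \<delta> x) \<le> shell_cutoff_grad \<delta> x \<bullet> x"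
proof -
  define h where "h = 2 / \<delta> * spline_hat (((norm x)\<^sup>2 - 1 - \<delta>) / \<delta>)"
  have h: "0 \<le> h" using assms spline_hat_nonneg by (simp add: h_def)
  show ?thesis
  proof (cases "1 \<le> norm x")
    case True
    then have "norm x * 1 \<le> norm x * norm x" by (intro mult_left_mono) auto
    then have "h * norm x \<le> h * (norm x)\<^sup>2"
      using h by (intro mult_left_mono) (auto simp: power2_eq_square)
    then show ?thesis
      using h unfolding shell_cutoff_grad_def h_def[symmetric] by (simp add: power2_norm_eq_inner)
  next
    case False
    then have "(norm x)\<^sup>2 \<le> 1" by (simp add: power_le_one)
    then have "h = 0" using assms by (simp add: h_def spline_hat_eq_0 divide_nonpos_pos)
    then show ?thesis unfolding shell_cutoff_grad_def h_def[symmetric] by simp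
  qed
qed

lemma shell_cutoff_grad_support:
  assumes "0 < \<delta>" "shell_cutoff_grad \<delta> x \<noteq> 0"
  shows "1 + \<delta> < (norm x)\<^sup>2" "(norm x)\<^sup>2 < 1 + 2 * \<delta>"
proof -
  have "spline_hat (((norm x)\<^sup>2 - 1 - \<delta>) / \<delta>) \<noteq> 0"
    using assms(2) by (auto simp: shell_cutoff_grad_def)
  then have "0 < ((norm x)\<^sup>2 - 1 - \<delta>) / \<delta>" "((norm x)\<^sup>2 - 1 - \<delta>) / \<delta> < 1"
    using spline_hat_eq_0 by (meson not_le)+
  then show "1 + \<delta> < (norm x)\<^sup>2" "(norm x)\<^sup>2 < 1 + 2 * \<delta>"
    using assms(1) by (auto simp: zero_less_divide_iff field_simps)
qed

text \<open>On the sphere \<open>zt\<close> vanishes along with the boundary values, so by uniform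
  continuity |zx| |zt| is below any given \<omega> on a thin enough shell. There the cutoff gradient
  has weighted mass at most \<open>M\<close>, independently of the thickness, so the energy is at
  most \<open>2 * (\<omega> * M) * s\<close> for every \<omega> > 0.\<close>

lemma exterior_uniqueness:
  assumes jet: "wave_jet (- cball 0 1) {0..\<tau>} z zt ztt zx zxt zxx"
    and init: "\<And>x. 1 < norm x \<Longrightarrow> z x 0 = 0 \<and> zt x 0 = 0"
    and bdry: "\<And>x t. norm x = 1 \<Longrightarrow> 0 \<le> t \<Longrightarrow> t \<le> \<tau> \<Longrightarrow> z x t = 0"
    and x: "1 < norm x" and t: "0 \<le> t" "t \<le> \<tau>"
  shows "z x t = 0"
proof -
  interpret wave_jet "- cball 0 1" "{0..\<tau>}" z zt ztt zx zxt zxx by fact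
  have init_zx: "zx x 0 = 0" if "1 < norm x" for x
    using spatial_gradient_initial[of "- cball 0 1" 0 x] init t that by (simp add: open_Compl)
  have cl: "closure (- cball 0 1) = - ball (0::real^3) 1"
    by (simp add: closure_complement interior_cball)
  \<comment> \<open>Keeps \<open>x\<close> inside the cone about the origin up to time
    \<tau>.\<close>
  define R where "R = norm x + \<tau> + 1"
  have R: "1 < R" "\<tau> \<le> R" "norm x < R" using x t by (auto simp: R_def)
  have zt_bdry: "zt y r = 0" if "norm y = 1" "0 < r" "r < \<tau>" for y r
  proof -
    have "(z y has_real_derivative zt y r) (at r)"
      using z_t[of y r] that at_within_interior[of r "{0..\<tau>}"] by (simp add: cl)
    moreover have "(z y has_real_derivative 0) (at r)"
      by (rule has_field_derivative_transform_within_open[OF DERIV_const, of "{0<..<\<tau>}"])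
         (use that bdry in auto)
    ultimately show ?thesis by (rule DERIV_unique)
  qed
  define Q where "Q p = norm (zx (fst p) (snd p)) * \<bar>zt (fst p) (snd p)\<bar>" for p
  define C where "C = (cball 0 R - ball (0::real^3) 1) \<times> {0..\<tau>}"
  have uQ: "uniformly_continuous_on C Q"
  proof (rule compact_uniformly_continuous)
    show "compact C" unfolding C_def by (intro compact_Times compact_diff) auto
    show "continuous_on C Q" unfolding Q_def
      by (intro continuous_intros continuous_on_subset[OF cont_zt] continuous_on_subset[OF cont_zx])
         (auto simp: C_def cl)
  qed
  obtain c where c: "cball (0::real^3) R \<subseteq> box (- c) c"
    using bounded_subset_box_symmetric[OF bounded_cball] by blast
  then have c': "cball 0 R \<subseteq> cbox (- c) c" using box_subset_cbox by blast
  define E where "E \<delta> r = integral (cbox (- c) c) (\<lambda>x. shell_cutoff \<delta> x * (cone_gap 0 R x r)\<^sup>2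
      * ((zt x r)\<^sup>2 + (norm (zx x r))\<^sup>2))" for \<delta> r
  have zt0: "zt x s = 0" if s: "0 < s" "s < t" for s
  proof -
    \<comment> \<open>With this thickness the cutoff equals 1 at \<open>x\<close>.\<close>
    define \<delta>0 where "\<delta>0 = ((norm x)\<^sup>2 - 1) / 2"
    have \<delta>0: "0 < \<delta>0" using x by (simp add: \<delta>0_def)
    define M where "M = 4 * R^4 * measure lborel (cbox (- c) c)"
    have M: "0 \<le> M" by (simp add: M_def)
    have K: "closed {x::real^3. 1 + \<delta> \<le> (norm x)\<^sup>2}" "{x::real^3. 1 + \<delta> \<le> (norm x)\<^sup>2} \<subseteq> - cball 0 1"
      "\<And>x. x \<notin> {x::real^3. 1 + \<delta> \<le> (norm x)\<^sup>2} \<Longrightarrow> shell_cutoff \<delta> x = 0" if "0 < \<delta>" for \<delta>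
    proof -
      show "closed {x::real^3. 1 + \<delta> \<le> (norm x)\<^sup>2}" by (intro closed_Collect_le continuous_intros)
      show "{x::real^3. 1 + \<delta> \<le> (norm x)\<^sup>2} \<subseteq> - cball 0 1"
      proof
        fix x :: "real^3" assume "x \<in> {x. 1 + \<delta> \<le> (norm x)\<^sup>2}"
        then have "1 < (norm x)\<^sup>2" using that by simp
        then show "x \<in> - cball 0 1" using power_le_one[of "norm x" 2] by force
      qed
      show "shell_cutoff \<delta> x = 0" if "x \<notin> {x::real^3. 1 + \<delta> \<le> (norm x)\<^sup>2}" for x
        using that \<open>0 < \<delta>\<close> unfolding shell_cutoff_def
        by (intro spline_step_eq_0) (auto simp: divide_nonpos_pos)
    qed
    have int: "(\<lambda>x. shell_cutoff \<delta> x * (cone_gap 0 R x s)\<^sup>2 * ((zt x s)\<^sup>2 + (norm (zx x s))\<^sup>2))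
        integrable_on cbox (- c) c" if "0 < \<delta>" for \<delta>
    proof (rule integrable_continuous, rule continuous_on_zero_extension)
      have slice: "continuous_on (- cball 0 1) (\<lambda>x. f x s)"
        if "continuous_on (closure (- cball 0 1) \<times> {0..\<tau>}) (\<lambda>p. f (fst p) (snd p))"
        for f :: "real^3 \<Rightarrow> real \<Rightarrow> 'z::topological_space"
      proof -
        have "continuous_on (- cball 0 1) (\<lambda>x. (\<lambda>p. f (fst p) (snd p)) (x, s))"
          by (rule continuous_on_compose2[OF that])
             (use s t in \<open>auto simp: cl intro!: continuous_intros\<close>)
        then show ?thesis by simp
      qed
      show "continuous_on (cbox (- c) c \<inter> - cball 0 1)
        (\<lambda>x. shell_cutoff \<delta> x * (cone_gap 0 R x s)\<^sup>2 * ((zt x s)\<^sup>2 + (norm (zx x s))\<^sup>2))"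
        by (intro continuous_intros continuous_on_subset[OF continuous_shell_cutoff(1)[OF that]]
            continuous_on_subset[OF slice[OF cont_zt]] continuous_on_subset[OF slice[OF cont_zx]]) auto
      show "open (- {x::real^3. 1 + \<delta> \<le> (norm x)\<^sup>2})" using K(1)[OF that] by (simp add: open_Compl)
    qed (use K[OF that] in auto)
    have small: "E \<delta>0 s \<le> 2 * (\<omega> * M) * s" if \<omega>: "0 < \<omega>" for \<omega>
    proof -
      obtain d where d: "0 < d" "\<And>p q. p \<in> C \<Longrightarrow> q \<in> C \<Longrightarrow> dist q p < d \<Longrightarrow> dist (Q q) (Q p) < \<omega>"
        using uQ \<omega> unfolding uniformly_continuous_on_def by blast
      \<comment> \<open>On the support of the cutoff gradient |y| - 1 \<le> |y|^2 - 1 < 2 \<delta>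
        \<le> d, so it lies within distance \<open>d\<close> of the sphere.\<close>
      define \<delta> where "\<delta> = min \<delta>0 (d / 2)"
      have \<delta>: "0 < \<delta>" "\<delta> \<le> \<delta>0" "2 * \<delta> \<le> d" using \<delta>0 d by (auto simp: \<delta>_def)
      have Q_small: "Q (y, r) \<le> \<omega>"
        if "shell_cutoff_grad \<delta> y \<noteq> 0" "norm y < R" "0 < r" "r < \<tau>" for y r
      proof -
        have y: "1 < (norm y)\<^sup>2" "(norm y)\<^sup>2 < 1 + d"
          using shell_cutoff_grad_support[OF \<delta>(1) that(1)] \<delta> by linarith+
        have ny: "1 < norm y" using y(1) power_le_one[of "norm y" 2] by force
        then have "norm y * 1 \<le> norm y * norm y" by (intro mult_left_mono) auto
        with y have "norm y - 1 < d" by (simp add: power2_eq_square)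
        \<comment> \<open>The radial projection of \<open>y\<close> to the sphere, where
          \<open>Q\<close> is 0.\<close>
        define w where "w = y /\<^sub>R norm y"
        have "y \<noteq> 0" using ny by auto
        then have nw: "norm w = 1" by (simp add: w_def)
        have "norm y *\<^sub>R w = y" using \<open>y \<noteq> 0\<close> by (simp add: w_def)
        then have "y - w = (norm y - 1) *\<^sub>R w" by (simp add: scaleR_left_diff_distrib)
        then have "dist y w = norm y - 1" using ny nw by (simp add: dist_norm)
        then have "dist (y, r) (w, r) < d" using \<open>norm y - 1 < d\<close> ny by (simp add: dist_Pair_Pair)
        then have "dist (Q (y, r)) (Q (w, r)) < \<omega>"
          using ny nw that R by (intro d(2)) (auto simp: C_def)
        moreover have "Q (w, r) = 0" using zt_bdry[OF nw that(3,4)] by (simp add: Q_def)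
        ultimately show ?thesis by (simp add: dist_real_def)
      qed
      have "E \<delta> s \<le> 2 * (\<omega> * M) * s"
        unfolding E_def
      proof (rule energy_estimate[where g\<eta> = "shell_cutoff_grad \<delta>" and \<tau> = \<tau>
            and K = "{x. 1 + \<delta> \<le> (norm x)\<^sup>2}"])
        show "integral (cbox (- c) c) (\<lambda>x. (cone_gap 0 R x r)\<^sup>2 *
          (norm (shell_cutoff_grad \<delta> x) * (norm (zx x r) * \<bar>zt x r\<bar>))) \<le> \<omega> * M"
          if r: "0 < r" "r < \<tau>" for r
        proof -
          let ?G = "\<lambda>x. cone_gap 0 R x r" and ?g = "shell_cutoff_grad \<delta>"
          have pw: "(?G x)\<^sup>2 * (norm (?g x) * (norm (zx x r) * \<bar>zt x r\<bar>))
              \<le> \<omega> * ((?G x)\<^sup>2 * (?g x \<bullet> x))" for x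
          proof (cases "?g x = 0 \<or> R \<le> norm x")
            case True
            then show ?thesis using cone_gap_eq_0[of r R x 0] r R by auto
          next
            case False
            then have "Q (x, r) \<le> \<omega>" using Q_small[of x r] r by auto
            then have "norm (?g x) * Q (x, r) \<le> (?g x \<bullet> x) * \<omega>"
              using shell_cutoff_grad_norm[OF \<delta>(1), of x]
              by (intro mult_mono) (auto simp: Q_def intro: order_trans[OF norm_ge_zero])
            from mult_left_mono[OF this, of "(?G x)\<^sup>2"] show ?thesis
              by (simp add: Q_def mult_ac)
          qed
          have cg: "continuous_on S (shell_cutoff_grad \<delta>)" for S
            using continuous_shell_cutoff(2)[OF \<delta>(1)] continuous_on_subset by blast
          have lhs: "(\<lambda>x. (?G x)\<^sup>2 * (norm (?g x) * (norm (zx x r) * \<bar>zt x r\<bar>))) integrable_on cbox (- c) c"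
          proof (rule integrable_continuous, rule continuous_on_zero_extension)
            have slice: "continuous_on (- cball 0 1) (\<lambda>x. f x r)"
              if "continuous_on (closure (- cball 0 1) \<times> {0..\<tau>}) (\<lambda>p. f (fst p) (snd p))"
              for f :: "real^3 \<Rightarrow> real \<Rightarrow> 'z::topological_space"
            proof -
              have "continuous_on (- cball 0 1) (\<lambda>x. (\<lambda>p. f (fst p) (snd p)) (x, r))"
                by (rule continuous_on_compose2[OF that])
                   (use r t in \<open>auto simp: cl intro!: continuous_intros\<close>)
              then show ?thesis by simp
            qed
            show "continuous_on (cbox (- c) c \<inter> - cball 0 1)
              (\<lambda>x. (?G x)\<^sup>2 * (norm (?g x) * (norm (zx x r) * \<bar>zt x r\<bar>)))"
              by (intro continuous_intros cg
                  continuous_on_subset[OF slice[OF cont_zt]] continuous_on_subset[OF slice[OF cont_zx]]) auto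
            show "open (- {x::real^3. 1 + \<delta> \<le> (norm x)\<^sup>2})" using K(1)[OF \<delta>(1)] by (simp add: open_Compl)
            show "(?G x)\<^sup>2 * (norm (?g x) * (norm (zx x r) * \<bar>zt x r\<bar>)) = 0"
              if "x \<in> - {x::real^3. 1 + \<delta> \<le> (norm x)\<^sup>2}" for x
              using shell_cutoff_grad_support(1)[OF \<delta>(1), of x] that by auto
          qed (use K(2)[OF \<delta>(1)] in auto)
          have "integral (cbox (- c) c) (\<lambda>x. (?G x)\<^sup>2 * (norm (?g x) * (norm (zx x r) * \<bar>zt x r\<bar>)))
              \<le> integral (cbox (- c) c) (\<lambda>x. \<omega> * ((?G x)\<^sup>2 * (?g x \<bullet> x)))"
            by (intro integral_le lhs pw integrable_continuous continuous_intros cg)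
          also have "\<dots> \<le> \<omega> * M"
            unfolding integral_mult_right M_def
            using shell_flux_bound[OF \<delta>(1) _ _ c', of r] r R \<omega> by (intro mult_left_mono) auto
          finally show ?thesis .
        qed
      qed (use R c' init init_zx K[OF \<delta>(1)] shell_cutoff_deriv[OF \<delta>(1)] continuous_shell_cutoff[OF \<delta>(1)]
            s t in \<open>auto simp: shell_cutoff_def spline_step_nonneg\<close>)
      moreover have "E \<delta>0 s \<le> E \<delta> s"
        unfolding E_def
        by (intro integral_le int \<delta>0 \<delta>(1) mult_right_mono shell_cutoff_antimono \<delta>(2)) auto
      ultimately show ?thesis by linarith
    qed
    have energy: "E \<delta>0 s \<le> 0"
    proof (rule field_le_epsilon)
      fix \<epsilon> :: real assume "0 < \<epsilon>"
      \<comment> \<open>Adding 1 gives a positive denominator without knowing that \<open>M\<close>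
        is positive.\<close>
      moreover have Ms: "0 < 2 * M * s + 1" using M s by (simp add: add_nonneg_pos)
      ultimately have "E \<delta>0 s \<le> 2 * (\<epsilon> / (2 * M * s + 1) * M) * s" by (intro small) simp
      also have "\<dots> = \<epsilon> * (2 * M * s / (2 * M * s + 1))" by simp
      also have "\<dots> \<le> \<epsilon> * 1" using Ms \<open>0 < \<epsilon>\<close> by (intro mult_left_mono) auto
      finally show "E \<delta>0 s \<le> 0 + \<epsilon>" by simp
    qed
    show "zt x s = 0"
    proof (rule time_deriv_eq_0_of_energy[OF refl])
      show "integral (cbox (- c) c) (\<lambda>x. shell_cutoff \<delta>0 x * (cone_gap 0 R x s)\<^sup>2
        * ((zt x s)\<^sup>2 + (norm (zx x s))\<^sup>2)) \<le> 0"
        using energy by (simp add: E_def)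
      have "x \<in> cball 0 R" using R by simp
      then show "x \<in> cbox (- c) c" "box (- c) c \<noteq> {}" using c c' by blast+
      have "((norm x)\<^sup>2 - 1 - \<delta>0) / \<delta>0 = 1" using \<delta>0 by (simp add: \<delta>0_def field_simps)
      then show "0 < shell_cutoff \<delta>0 x" unfolding shell_cutoff_def by (simp only: spline_step_eq_1)
      show "0 < cone_gap 0 R x s" using s t x R by (subst cone_gap_pos_iff) (auto simp: R_def)
    qed (use K[OF \<delta>0] continuous_shell_cutoff[OF \<delta>0] s t in
         \<open>auto simp: shell_cutoff_def spline_step_nonneg\<close>)
  qed
  show ?thesis
    by (rule eq_0_of_time_deriv_eq_0[of \<tau>]) (use x init[of x] t zt0 in auto)
qed

section \<open>Huygens' principle\<close>

text \<open>On a cube of side \<open>2 * \<epsilon>\<close> around \<open>x0\<close> the weight is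
  of order \<open>1/\<epsilon>^4\<close>, so a positive value at \<open>x0\<close> contributes at
  least a multiple of \<open>1/\<epsilon>\<close>. Negative values of \<open>f\<close> occur only at
  a fixed distance from \<open>x0\<close>, and their contribution stays bounded.\<close>

lemma singular_kernel_not_bounded:
  fixes f :: "real^3 \<Rightarrow> real"
  assumes cont: "continuous_on (cbox a b) f" and x0: "x0 \<in> box a b" "0 < f x0" and \<epsilon>0: "0 < \<epsilon>0"
    and bound: "\<And>\<epsilon>. 0 < \<epsilon> \<Longrightarrow> \<epsilon> < \<epsilon>0 \<Longrightarrow>
      integral (cbox a b) (\<lambda>x. f x / (\<epsilon>\<^sup>2 + (norm (x - x0))\<^sup>2)\<^sup>2) \<le> C"
  shows False
proof -
  define k where "k = f x0"
  have k: "0 < k" using x0 by (simp add: k_def)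
  have x0': "x0 \<in> cbox a b" using x0 box_subset_cbox by blast
  obtain \<rho> where \<rho>: "0 < \<rho>" "\<And>x. x \<in> cbox a b \<Longrightarrow> dist x x0 < \<rho> \<Longrightarrow> k / 2 \<le> f x"
  proof -
    obtain \<rho> where \<rho>: "0 < \<rho>" "\<And>x. x \<in> cbox a b \<Longrightarrow> dist x x0 < \<rho> \<Longrightarrow> dist (f x) (f x0) < k / 2"
      using cont x0' k unfolding continuous_on_iff by (metis half_gt_zero)
    show thesis
    proof (rule that[OF \<rho>(1)])
      fix x assume "x \<in> cbox a b" "dist x x0 < \<rho>"
      then have "\<bar>f x - k\<bar> < k / 2" using \<rho>(2)[of x] by (simp add: dist_real_def k_def)
      then have "- (k / 2) < f x - k" using abs_ge_minus_self[of "f x - k"] by linarith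
      then show "k / 2 \<le> f x" by (simp add: field_simps)
    qed
  qed
  obtain r where r: "0 < r" "ball x0 r \<subseteq> box a b" using x0(1) open_box by (meson open_contains_ball)
  have "bounded (f ` cbox a b)" by (intro compact_imp_bounded compact_continuous_image cont) auto
  then obtain B where B: "0 < B" "\<And>x. x \<in> cbox a b \<Longrightarrow> \<bar>f x\<bar> \<le> B"
    unfolding bounded_pos by auto
  \<comment> \<open>Farther than \<rho> from \<open>x0\<close> the weight is at most
    \<open>1/\<rho>^4\<close>, so adding \<open>D\<close> makes the integrand nonnegative on the
    whole box.\<close>
  define D where "D = B / \<rho>^4"
  define C' where "C' = \<bar>C\<bar> + D * measure lborel (cbox a b) + 1"
  have D: "0 \<le> D" using B \<rho> by (simp add: D_def)
  have C': "0 < C'" using D by (simp add: C'_def add_nonneg_pos)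
  \<comment> \<open>The last bound makes \<open>k / (25 * \<epsilon>)\<close>, the lower bound
    obtained for the integral, exceed \<open>C'\<close>.\<close>
  define \<epsilon> where "\<epsilon> = min (\<epsilon>0 / 2) (min (\<rho> / 4) (min (r / 4) (k / (50 * C'))))"
  have \<epsilon>: "0 < \<epsilon>" "\<epsilon> < \<epsilon>0" "3 * \<epsilon> < \<rho>" "3 * \<epsilon> < r"
    using \<epsilon>0 \<rho>(1) r(1) k C' by (auto simp: \<epsilon>_def min_def)
  have \<epsilon>k: "25 * C' * \<epsilon> < k"
  proof -
    have "\<epsilon> \<le> k / (50 * C')" by (simp add: \<epsilon>_def)
    then have "50 * C' * \<epsilon> \<le> k" using C' by (simp add: field_simps)
    then show ?thesis using k by linarith
  qed
  define w where "w x = 1 / (\<epsilon>\<^sup>2 + (norm (x - x0))\<^sup>2)\<^sup>2" for x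
  have pos: "0 < \<epsilon>\<^sup>2 + (norm (x - x0))\<^sup>2" for x using \<epsilon> by (simp add: add_pos_nonneg)
  have w0: "0 \<le> w x" for x by (simp add: w_def)
  have cw: "continuous_on S w" for S
    unfolding w_def[abs_def] using pos by (intro continuous_intros) (use \<epsilon>(1) in auto)
  define h where "h x = f x * w x + D" for x
  have ch: "continuous_on (cbox a b) h"
    unfolding h_def by (intro continuous_intros cont cw)
  have h0: "0 \<le> h x" if x: "x \<in> cbox a b" for x
  proof (cases "dist x x0 < \<rho>")
    case True
    then have "0 \<le> f x" using \<rho>(2)[OF x] k by linarith
    then show ?thesis using w0[of x] D by (simp add: h_def)
  next
    case False
    then have "\<rho>^2 \<le> (norm (x - x0))\<^sup>2" using \<rho>(1) by (intro power_mono) (auto simp: dist_norm)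
    then have "\<rho>^2 \<le> \<epsilon>\<^sup>2 + (norm (x - x0))\<^sup>2" using zero_le_power2[of \<epsilon>] by linarith
    then have "(\<rho>^2)^2 \<le> (\<epsilon>\<^sup>2 + (norm (x - x0))\<^sup>2)\<^sup>2" by (rule power_mono) simp
    then have "w x \<le> 1 / \<rho>^4"
      using \<rho>(1) unfolding w_def by (intro divide_left_mono mult_pos_pos zero_less_power pos) auto
    then have "B * w x \<le> D" using B(1) mult_left_mono[of "w x" "1 / \<rho>^4" B] by (simp add: D_def)
    moreover have "- B * w x \<le> f x * w x"
      using B(2)[OF x] w0[of x] by (intro mult_right_mono) (auto simp: abs_le_iff)
    ultimately show ?thesis by (simp add: h_def)
  qed
  let ?Q = "cbox (x0 - \<epsilon> *\<^sub>R One) (x0 + \<epsilon> *\<^sub>R One)"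
  have Qnorm: "norm (x - x0) \<le> 3 * \<epsilon>" if "x \<in> ?Q" for x
  proof -
    have "\<bar>(x - x0) \<bullet> i\<bar> \<le> \<epsilon>" if "i \<in> Basis" for i
      using \<open>x \<in> ?Q\<close> that by (auto simp: mem_box algebra_simps abs_le_iff)
    then have "(\<Sum>i\<in>Basis. \<bar>(x - x0) \<bullet> i\<bar>) \<le> of_nat (card (Basis :: (real^3) set)) * \<epsilon>"
      by (rule sum_bounded_above)
    then show ?thesis using norm_le_l1[of "x - x0"] by simp
  qed
  have Qsub: "?Q \<subseteq> cbox a b"
  proof
    fix x assume "x \<in> ?Q"
    then have "x \<in> ball x0 r" using Qnorm[of x] \<epsilon> by (simp add: dist_norm norm_minus_commute)
    then show "x \<in> cbox a b" using r(2) box_subset_cbox by blast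
  qed
  \<comment> \<open>On the cube |x - x0| \<le> 3 \<epsilon>, so the weight is at least
    \<open>1 / (10 * \<epsilon>\<^sup>2)\<^sup>2\<close>, while \<open>f\<close> is at least
    \<open>k / 2\<close>. Multiplying by the volume \<open>8 * \<epsilon>^3\<close> gives
    \<open>k / (25 * \<epsilon>)\<close>.\<close>
  have hQ: "k / (200 * \<epsilon>^4) \<le> h x" if x: "x \<in> ?Q" for x
  proof -
    have "(norm (x - x0))\<^sup>2 \<le> (3 * \<epsilon>)\<^sup>2" using Qnorm[OF x] by (intro power_mono) auto
    then have "\<epsilon>\<^sup>2 + (norm (x - x0))\<^sup>2 \<le> 10 * \<epsilon>\<^sup>2" by (simp add: power_mult_distrib)
    then have "(\<epsilon>\<^sup>2 + (norm (x - x0))\<^sup>2)\<^sup>2 \<le> (10 * \<epsilon>\<^sup>2)\<^sup>2" using pos[of x] by (intro power_mono) auto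
    then have "1 / (10 * \<epsilon>\<^sup>2)\<^sup>2 \<le> w x"
      unfolding w_def using \<epsilon>(1) by (intro divide_left_mono mult_pos_pos zero_less_power pos) auto
    then have "1 / (100 * \<epsilon>^4) \<le> w x" by (simp add: power_mult_distrib)
    moreover have "k / 2 \<le> f x"
      using \<rho>(2) Qsub x Qnorm[OF x] \<epsilon> by (auto simp: dist_norm)
    ultimately have "(k / 2) * (1 / (100 * \<epsilon>^4)) \<le> f x * w x"
      using k \<epsilon> by (intro mult_mono) auto
    then show ?thesis using D by (simp add: h_def)
  qed
  have "measure lborel ?Q = (\<Prod>i\<in>(Basis :: (real^3) set). 2 * \<epsilon>)"
    using \<epsilon>(1) by (subst content_cbox) (auto simp: algebra_simps intro!: prod.cong)
  then have mQ: "measure lborel ?Q = 8 * \<epsilon>^3" by (simp add: power_mult_distrib)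
  have hint: "h integrable_on cbox a b" "h integrable_on ?Q"
    using ch continuous_on_subset[OF ch Qsub] by (auto intro: integrable_continuous)
  have "k / (25 * \<epsilon>) = measure lborel ?Q * (k / (200 * \<epsilon>^4))"
    using \<epsilon>(1) unfolding mQ by (simp add: field_simps power_numeral_reduce)
  also have "\<dots> = integral ?Q (\<lambda>x. k / (200 * \<epsilon>^4))" by simp
  also have "\<dots> \<le> integral ?Q h" by (intro integral_le hint hQ) auto
  also have "\<dots> \<le> integral (cbox a b) h" by (intro integral_subset_le Qsub hint) (use h0 in auto)
  also have "\<dots> = integral (cbox a b) (\<lambda>x. f x * w x) + integral (cbox a b) (\<lambda>x. D)"
    unfolding h_def
    by (intro integral_add integrable_continuous continuous_intros cont cw)
  also have "\<dots> \<le> C + D * measure lborel (cbox a b)"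
    using bound[OF \<epsilon>(1,2)] by (simp add: w_def mult.commute)
  also have "\<dots> < C'" by (simp add: C'_def)
  finally show False using \<epsilon>k \<epsilon>(1) by (simp add: field_simps)
qed

lemma singular_kernel_eq_0:
  fixes f :: "real^3 \<Rightarrow> real"
  assumes cont: "continuous_on (cbox a b) f" and x0: "x0 \<in> box a b" and \<epsilon>0: "0 < \<epsilon>0"
    and bound: "\<And>\<epsilon>. 0 < \<epsilon> \<Longrightarrow> \<epsilon> < \<epsilon>0 \<Longrightarrow>
      \<bar>integral (cbox a b) (\<lambda>x. f x / (\<epsilon>\<^sup>2 + (norm (x - x0))\<^sup>2)\<^sup>2)\<bar> \<le> C"
  shows "f x0 = 0"
proof (rule ccontr)
  assume "f x0 \<noteq> 0"
  then consider "0 < f x0" | "0 < - f x0" by linarith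
  then show False
  proof cases
    case 1
    show False
      by (rule singular_kernel_not_bounded[OF cont x0 1 \<epsilon>0]) (use bound in \<open>auto simp: abs_le_iff\<close>)
  next
    case 2
    show False
      by (rule singular_kernel_not_bounded[of a b "\<lambda>x. - f x" x0 \<epsilon>0 C])
         (use bound 2 x0 \<epsilon>0 in \<open>auto simp: abs_le_iff intro!: continuous_intros cont\<close>)
  qed
qed

section \<open>The regularised kernel as a function of time and squared radius\<close>

definition kernel_den :: "real \<Rightarrow> real \<Rightarrow> real \<Rightarrow> real" where
  "kernel_den c s \<rho> = (s\<^sup>2 - c - \<rho>)\<^sup>2 + 4 * c * s\<^sup>2"

text \<open>
  With \<open>\<sigma> = (s - i\<surd>c)\<^sup>2 - \<rho>\<close> and \<open>\<rho> = |x|\<^sup>2\<close>, the function \<open>1/\<sigma>\<close> solves the wave equation in \<open>(x, s)\<close>;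
  \<open>kernel_den\<close> is \<open>|\<sigma>|\<^sup>2\<close>, and \<open>kernel\<close> is the imaginary part of \<open>1/\<sigma>\<close> divided by \<open>2\<surd>c\<close>. It has no
  singularity for \<open>c > 0\<close>.
\<close>

definition kernel :: "real \<Rightarrow> real \<Rightarrow> real \<Rightarrow> real" where
  "kernel c s \<rho> = s / kernel_den c s \<rho>"

definition kernel_s :: "real \<Rightarrow> real \<Rightarrow> real \<Rightarrow> real" where
  "kernel_s c s \<rho> = (kernel_den c s \<rho> - s * (4 * s * (s\<^sup>2 + c - \<rho>))) / (kernel_den c s \<rho>)\<^sup>2"

definition kernel_ss :: "real \<Rightarrow> real \<Rightarrow> real \<Rightarrow> real" where
  "kernel_ss c s \<rho> = (- s * (12 * s\<^sup>2 + 4 * c - 4 * \<rho>) * kernel_den c s \<rho>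
     - 2 * (4 * s * (s\<^sup>2 + c - \<rho>)) * (kernel_den c s \<rho> - s * (4 * s * (s\<^sup>2 + c - \<rho>))))
     / (kernel_den c s \<rho>)^3"

definition kernel_r :: "real \<Rightarrow> real \<Rightarrow> real \<Rightarrow> real" where
  "kernel_r c s \<rho> = 2 * s * (s\<^sup>2 - c - \<rho>) / (kernel_den c s \<rho>)\<^sup>2"

definition kernel_rr :: "real \<Rightarrow> real \<Rightarrow> real \<Rightarrow> real" where
  "kernel_rr c s \<rho> = (8 * s * (s\<^sup>2 - c - \<rho>)\<^sup>2 - 2 * s * kernel_den c s \<rho>) / (kernel_den c s \<rho>)^3"

lemma kernel_den_pos:
  assumes "0 < c" "0 \<le> \<rho>"
  shows "0 < kernel_den c s \<rho>"
proof (cases "s = 0")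
  case True
  then show ?thesis using assms by (simp add: kernel_den_def)
next
  case False
  then show ?thesis using assms by (simp add: kernel_den_def add_nonneg_pos)
qed

lemma kernel_den_deriv_s:
  "((\<lambda>s. kernel_den c s \<rho>) has_real_derivative 4 * s * (s\<^sup>2 + c - \<rho>)) (at s)"
  unfolding kernel_den_def
  by (auto intro!: derivative_eq_intros simp: algebra_simps power2_eq_square power3_eq_cube)

lemma kernel_den_deriv_r:
  "((\<lambda>\<rho>. kernel_den c s \<rho>) has_real_derivative - 2 * (s\<^sup>2 - c - \<rho>)) (at \<rho>)"
  unfolding kernel_den_def
  by (auto intro!: derivative_eq_intros simp: algebra_simps)

lemma kernel_deriv_s:
  assumes "kernel_den c s \<rho> \<noteq> 0"
  shows "((\<lambda>s. kernel c s \<rho>) has_real_derivative kernel_s c s \<rho>) (at s)"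
  unfolding kernel_def kernel_s_def
  by (rule DERIV_cong[OF DERIV_divide[OF DERIV_ident kernel_den_deriv_s assms]])
     (simp add: power2_eq_square)

lemma kernel_s_deriv_s:
  assumes "kernel_den c s \<rho> \<noteq> 0"
  shows "((\<lambda>s. kernel_s c s \<rho>) has_real_derivative kernel_ss c s \<rho>) (at s)"
proof -
  let ?N = "kernel_den c s \<rho>" and ?Nt = "4 * s * (s\<^sup>2 + c - \<rho>)"
  have n: "((\<lambda>s. 4 * s * (s\<^sup>2 + c - \<rho>)) has_real_derivative 12 * s\<^sup>2 + 4 * c - 4 * \<rho>) (at s)"
    by (auto intro!: derivative_eq_intros simp: algebra_simps power2_eq_square)
  have num: "((\<lambda>s. kernel_den c s \<rho> - s * (4 * s * (s\<^sup>2 + c - \<rho>))) has_real_derivative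
      - s * (12 * s\<^sup>2 + 4 * c - 4 * \<rho>)) (at s)"
    by (rule DERIV_cong[OF DERIV_diff[OF kernel_den_deriv_s DERIV_mult[OF DERIV_ident n]]]) simp
  have den: "((\<lambda>s. (kernel_den c s \<rho>)\<^sup>2) has_real_derivative 2 * ?N * ?Nt) (at s)"
    by (rule DERIV_cong[OF DERIV_power[OF kernel_den_deriv_s]]) simp
  have "(\<alpha> * N\<^sup>2 - \<beta> * (2 * N * m)) / (N\<^sup>2 * N\<^sup>2) = (\<alpha> * N - 2 * m * \<beta>) / N^3"
    if "N \<noteq> 0" for \<alpha> \<beta> m N :: real
    using that by (simp add: field_simps power2_eq_square power3_eq_cube)
  from this[OF assms] show ?thesis
    unfolding kernel_s_def kernel_ss_def
    by (rule DERIV_cong[OF DERIV_divide[OF num den], rotated]) (use assms in simp)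
qed

lemma kernel_deriv_r:
  assumes "kernel_den c s \<rho> \<noteq> 0"
  shows "((\<lambda>\<rho>. kernel c s \<rho>) has_real_derivative kernel_r c s \<rho>) (at \<rho>)"
proof -
  have "(0 * N - s * (- 2 * A)) / (N * N) = 2 * s * A / N\<^sup>2" for A N :: real
    by (simp add: power2_eq_square)
  then show ?thesis
    unfolding kernel_def kernel_r_def
    by (rule DERIV_cong[OF DERIV_divide[OF DERIV_const kernel_den_deriv_r assms]])
qed

lemma kernel_r_deriv_r:
  assumes "kernel_den c s \<rho> \<noteq> 0"
  shows "((\<lambda>\<rho>. kernel_r c s \<rho>) has_real_derivative kernel_rr c s \<rho>) (at \<rho>)"
proof -
  let ?N = "kernel_den c s \<rho>"
  have num: "((\<lambda>\<rho>. 2 * s * (s\<^sup>2 - c - \<rho>)) has_real_derivative - 2 * s) (at \<rho>)"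
    by (auto intro!: derivative_eq_intros)
  have den: "((\<lambda>\<rho>. (kernel_den c s \<rho>)\<^sup>2) has_real_derivative 2 * ?N * (- 2 * (s\<^sup>2 - c - \<rho>))) (at \<rho>)"
    by (rule DERIV_cong[OF DERIV_power[OF kernel_den_deriv_r]]) simp
  have "(- 2 * s * N\<^sup>2 - 2 * s * A * (2 * N * (- 2 * A))) / (N\<^sup>2 * N\<^sup>2) = (8 * s * A\<^sup>2 - 2 * s * N) / N^3"
    if "N \<noteq> 0" for A N :: real
    using that by (simp add: field_simps power2_eq_square power3_eq_cube)
  from this[OF assms] show ?thesis
    unfolding kernel_r_def kernel_rr_def
    by (rule DERIV_cong[OF DERIV_divide[OF num den], rotated]) (use assms in simp)
qed

text \<open>In three dimensions the Laplacian of g(|x|^2) is 6 g' + 4 |x|^2 g'', so this is the wave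
  equation for the kernel. The 6 is twice the dimension, which is where dimension three
  enters.\<close>

lemma kernel_wave:
  assumes "kernel_den c s \<rho> \<noteq> 0"
  shows "kernel_ss c s \<rho> = 6 * kernel_r c s \<rho> + 4 * \<rho> * kernel_rr c s \<rho>"
proof -
  define N where "N = kernel_den c s \<rho>"
  have N: "N = (s\<^sup>2 - c - \<rho>)\<^sup>2 + 4 * c * s\<^sup>2" by (simp add: N_def kernel_den_def)
  have "- s * (12 * s\<^sup>2 + 4 * c - 4 * \<rho>) * N
      - 2 * (4 * s * (s\<^sup>2 + c - \<rho>)) * (N - s * (4 * s * (s\<^sup>2 + c - \<rho>)))
    = 12 * s * (s\<^sup>2 - c - \<rho>) * N + 4 * \<rho> * (8 * s * (s\<^sup>2 - c - \<rho>)\<^sup>2 - 2 * s * N)"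
    unfolding N power2_eq_square by (simp add: algebra_simps)
  then have "kernel_ss c s \<rho> = (12 * s * (s\<^sup>2 - c - \<rho>) * N
      + 4 * \<rho> * (8 * s * (s\<^sup>2 - c - \<rho>)\<^sup>2 - 2 * s * N)) / N^3"
    by (simp add: kernel_ss_def N_def)
  also have "\<dots> = 6 * kernel_r c s \<rho> + 4 * \<rho> * kernel_rr c s \<rho>"
    using assms unfolding kernel_r_def kernel_rr_def N_def[symmetric]
    by (simp add: add_divide_distrib power2_eq_square power3_eq_cube)
  finally show ?thesis .
qed

lemma continuous_kernel_den [continuous_intros]:
  assumes "continuous_on S f" "continuous_on S g" "continuous_on S h"
  shows "continuous_on S (\<lambda>p. kernel_den (f p) (g p) (h p))"
  unfolding kernel_den_def by (intro continuous_intros assms)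

lemma continuous_kernel:
  assumes "continuous_on S f" "continuous_on S g" "continuous_on S h"
    and "\<And>p. p \<in> S \<Longrightarrow> kernel_den (f p) (g p) (h p) \<noteq> 0"
  shows "continuous_on S (\<lambda>p. kernel (f p) (g p) (h p))"
    and "continuous_on S (\<lambda>p. kernel_s (f p) (g p) (h p))"
    and "continuous_on S (\<lambda>p. kernel_ss (f p) (g p) (h p))"
    and "continuous_on S (\<lambda>p. kernel_r (f p) (g p) (h p))"
    and "continuous_on S (\<lambda>p. kernel_rr (f p) (g p) (h p))"
  unfolding kernel_def kernel_s_def kernel_ss_def kernel_r_def kernel_rr_def
  by (intro continuous_intros assms; use assms(4) in force)+

text \<open>The pairing with the kernel is conserved by Green's identity. At time \<open>t1\<close>
  it is the singular integral of \<open>z\<close>; at a small time \<open>t0\<close> it is bounded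
  uniformly in the regularisation, as the support of \<open>z\<close> then lies strictly inside the
  cone of (x0, t1). The hypothesis \<open>supp\<close> is finite propagation speed, which keeps
  everything in one box.\<close>

lemma huygens:
  assumes jet: "wave_jet UNIV {0..\<tau>} z zt ztt zx zxt zxx"
    and supp: "\<And>x t. 0 \<le> t \<Longrightarrow> t \<le> \<tau> \<Longrightarrow> r + t < norm x \<Longrightarrow> z x t = 0"
    and r: "0 \<le> r" and t1: "norm x0 + r < t1" "t1 < \<tau>"
  shows "z x0 t1 = 0"
proof -
  interpret wave_jet UNIV "{0..\<tau>}" z zt ztt zx zxt zxx by fact
  have t1_pos: "0 < t1" using t1 r norm_ge_zero[of x0] by linarith
  have zt_supp: "zt x t = 0" if "0 < t" "t < \<tau>" "r + t < norm x" for x t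
  proof -
    have "(z x has_real_derivative zt x t) (at t)"
      using z_t[of x t] that at_within_interior[of t "{0..\<tau>}"] by simp
    moreover have "(z x has_real_derivative 0) (at t)"
      by (rule has_field_derivative_transform_within_open[OF DERIV_const, of "{0<..<\<tau>} \<inter> {..<norm x - r}"])
         (use that supp in auto)
    ultimately show ?thesis by (rule DERIV_unique)
  qed
  have zx_supp: "zx x t = 0" if "0 < t" "t < \<tau>" "r + t < norm x" for x t
    by (rule spatial_gradient_initial[of "- cball 0 (r + t)"])
       (use that supp in \<open>auto simp: open_Compl\<close>)
  obtain c where c: "cball (0::real^3) (r + \<tau>) \<subseteq> box (- c) c"
    using bounded_subset_box_symmetric[OF bounded_cball] by blast
  let ?B = "cbox (- c) c"
  have out: "r + t < norm x" if "x \<notin> ?B" "t < \<tau>" for x t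
  proof -
    have "x \<notin> cball 0 (r + \<tau>)" using that(1) c box_subset_cbox by blast
    then show ?thesis using that(2) by simp
  qed
  have cz: "continuous_on S (\<lambda>p. f (snd p) (fst p))"
    if "continuous_on (closure UNIV \<times> {0..\<tau>}) (\<lambda>p. f (fst p) (snd p))" "S \<subseteq> {0..\<tau>} \<times> UNIV"
    for S and f :: "real^3 \<Rightarrow> real \<Rightarrow> 'z::topological_space"
  proof -
    have "continuous_on S (\<lambda>p. (\<lambda>p. f (fst p) (snd p)) (snd p, fst p))"
      using that(2) by (intro continuous_on_compose2[OF that(1)] continuous_intros) auto
    then show ?thesis by simp
  qed
  have cz2: "continuous_on S (\<lambda>p. f (snd p) (fst p))"
    if "continuous_on (UNIV \<times> interior {0..\<tau>}) (\<lambda>p. f (fst p) (snd p))" "S \<subseteq> {0<..<\<tau>} \<times> UNIV"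
    for S and f :: "real^3 \<Rightarrow> real \<Rightarrow> 'z::topological_space"
  proof -
    have "continuous_on S (\<lambda>p. (\<lambda>p. f (fst p) (snd p)) (snd p, fst p))"
      using that(2) by (intro continuous_on_compose2[OF that(1)] continuous_intros) auto
    then show ?thesis by simp
  qed
  have slice: "continuous_on S (f t)" if "continuous_on ({0<..<\<tau>} \<times> UNIV) (\<lambda>p. f (fst p) (snd p))"
    "t \<in> {0<..<\<tau>}" for S t and f :: "real \<Rightarrow> real^3 \<Rightarrow> real"
  proof -
    have "continuous_on S (\<lambda>x. (\<lambda>p. f (fst p) (snd p)) (t, x))"
      by (rule continuous_on_compose2[OF that(1)]) (use that(2) in \<open>auto intro!: continuous_intros\<close>)
    then show ?thesis by simp
  qed
  define \<rho> where "\<rho> x = (norm (x - x0))\<^sup>2" for x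
  define k where "k e t x = z x t * kernel_s (e\<^sup>2) (t - t1) (\<rho> x) - zt x t * kernel (e\<^sup>2) (t - t1) (\<rho> x)" for e t x
  have c\<rho>: "continuous_on S (\<lambda>p. \<rho> (f p))" if "continuous_on S f" for S :: "'z::topological_space set" and f
    unfolding \<rho>_def by (intro continuous_intros that)
  have \<rho>0: "0 \<le> \<rho> x" for x by (simp add: \<rho>_def)
  have conserved: "integral ?B (k e t) = integral ?B (k e t')"
    if e: "0 < e" and tt: "0 < t'" "t' < t" "t < \<tau>" for e t t'
  proof -
    let ?c = "e\<^sup>2"
    have N: "kernel_den ?c s (\<rho> x) \<noteq> 0" for s x
      using kernel_den_pos[of ?c "\<rho> x" s] e \<rho>0 by simp
    define k' where "k' t x = z x t * kernel_ss ?c (t - t1) (\<rho> x) - ztt x t * kernel ?c (t - t1) (\<rho> x)" for t x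
    \<comment> \<open>The Green flux z grad q - q grad z for the kernel q; the factor
      \<open>2 * (x - x0) $ i\<close> is the derivative of \<rho>. Its divergence is
      \<open>k'\<close> because \<open>z\<close> and q both solve the wave equation.\<close>
    define F where "F t i x = z x t * (2 * (x - x0) $ i * kernel_r ?c (t - t1) (\<rho> x))
        - zx x t $ i * kernel ?c (t - t1) (\<rho> x)" for t i x
    define F' where "F' t i x = z x t * (2 * kernel_r ?c (t - t1) (\<rho> x)
        + 4 * ((x - x0) $ i)\<^sup>2 * kernel_rr ?c (t - t1) (\<rho> x))
        - zxx x t $ i * kernel ?c (t - t1) (\<rho> x)" for t i x
    note ck = continuous_kernel[OF _ _ _ N]
    have ckt: "continuous_on ({0<..<\<tau>} \<times> UNIV) (\<lambda>p. k e (fst p) (snd p))"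
      unfolding k_def by (intro continuous_intros ck c\<rho> cz[OF cont_z] cz[OF cont_zt]) auto
    have ck': "continuous_on ({0<..<\<tau>} \<times> UNIV) (\<lambda>p. k' (fst p) (snd p))"
      unfolding k'_def by (intro continuous_intros ck c\<rho> cz[OF cont_z] cz2[OF cont_ztt]) auto
    have cF: "continuous_on ({0<..<\<tau>} \<times> UNIV) (\<lambda>p. F (fst p) i (snd p))" for i
      unfolding F_def by (intro continuous_intros ck c\<rho> cz[OF cont_z] cz[OF cont_zx]) auto
    have cF': "continuous_on ({0<..<\<tau>} \<times> UNIV) (\<lambda>p. F' (fst p) i (snd p))" for i
      unfolding F'_def by (intro continuous_intros ck c\<rho> cz[OF cont_z] cz2[OF cont_zxx]) auto
    have k_t: "((\<lambda>t. k e t x) has_real_derivative k' t x) (at t)" if "t \<in> {0<..<\<tau>}" for t x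
    proof -
      have z: "(z x has_real_derivative zt x t) (at t)"
        using z_t[of x t] that at_within_interior[of t "{0..\<tau>}"] by simp
      have zt: "(zt x has_real_derivative ztt x t) (at t)" using zt_t[of x t] that by simp
      have s: "((\<lambda>t. t - t1) has_real_derivative 1) (at t)" by (auto intro!: derivative_eq_intros)
      note DERIV_diff[OF DERIV_mult[OF z DERIV_chain2[OF kernel_s_deriv_s[OF N] s]]
          DERIV_mult[OF zt DERIV_chain2[OF kernel_deriv_s[OF N] s]]]
      then show ?thesis unfolding k_def k'_def by (rule DERIV_cong) simp
    qed
    have F_x: "((\<lambda>s. F t i (x + s *\<^sub>R axis i 1)) has_real_derivative F' t i x) (at 0)"
      if "t \<in> {0<..<\<tau>}" for t i x
    proof -
      have z: "((\<lambda>s. z (x + s *\<^sub>R axis i 1) t) has_real_derivative zx x t $ i) (at 0)"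
        using z_x[of x t i] that by simp
      have zx: "((\<lambda>s. zx (x + s *\<^sub>R axis i 1) t $ i) has_real_derivative zxx x t $ i) (at 0)"
        using zx_x[of x t i] that by simp
      have y: "((\<lambda>s. 2 * (x + s *\<^sub>R axis i 1 - x0) $ i) has_real_derivative 2) (at 0)"
        by (auto intro!: derivative_eq_intros)
      have \<rho>x: "((\<lambda>s. \<rho> (x + s *\<^sub>R axis i 1)) has_real_derivative 2 * (x - x0) $ i) (at 0)"
        unfolding \<rho>_def by (rule norm_power2_deriv_axis)
      have q: "((\<lambda>s. kernel ?c (t - t1) (\<rho> (x + s *\<^sub>R axis i 1))) has_real_derivative
          kernel_r ?c (t - t1) (\<rho> x) * (2 * (x - x0) $ i)) (at 0)"
        using DERIV_chain2[OF kernel_deriv_r[OF N] \<rho>x] by simp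
      have qr: "((\<lambda>s. kernel_r ?c (t - t1) (\<rho> (x + s *\<^sub>R axis i 1))) has_real_derivative
          kernel_rr ?c (t - t1) (\<rho> x) * (2 * (x - x0) $ i)) (at 0)"
        using DERIV_chain2[OF kernel_r_deriv_r[OF N] \<rho>x] by simp
      show ?thesis unfolding F_def F'_def
        by (rule DERIV_cong[OF DERIV_diff[OF DERIV_mult[OF z DERIV_mult[OF y qr]] DERIV_mult[OF zx q]]])
           (simp add: algebra_simps power2_eq_square)
    qed
    have F'_int: "integral ?B (F' t i) = 0" if "t \<in> {0<..<\<tau>}" for t i
    proof (rule integral_directional_derivative_eq_0[OF F_x[OF that]])
      show "continuous_on UNIV (F t i)" using slice[OF cF that] .
      show "continuous_on UNIV (F' t i)" using slice[OF cF' that] .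
      show "F t i x = 0" if "x \<notin> ?B" for x
        using supp[of t x] zx_supp[of t x] out[OF that, of t] \<open>t \<in> _\<close> by (simp add: F_def)
    qed
    have k'_sum: "k' t x = (\<Sum>i\<in>UNIV. F' t i x)" if "t \<in> {0<..<\<tau>}" for t x
    proof -
      have "(\<Sum>i\<in>UNIV. F' t i x) = z x t * (6 * kernel_r ?c (t - t1) (\<rho> x)
          + 4 * (\<Sum>i\<in>UNIV. ((x - x0) $ i)\<^sup>2) * kernel_rr ?c (t - t1) (\<rho> x))
          - (\<Sum>i\<in>UNIV. zxx x t $ i) * kernel ?c (t - t1) (\<rho> x)"
        unfolding F'_def
        by (simp add: sum.distrib sum_subtractf sum_distrib_left sum_distrib_right distrib_left mult.assoc)
      moreover have "(\<Sum>i\<in>UNIV. ((x - x0) $ i)\<^sup>2) = \<rho> x"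
        unfolding \<rho>_def power2_norm_eq_inner inner_vec_def inner_real_def by (simp add: power2_eq_square)
      ultimately show ?thesis
        using kernel_wave[OF N] wave[of x t] that by (simp add: k'_def)
    qed
    have K_t: "((\<lambda>t. integral ?B (k e t)) has_real_derivative 0) (at t)" if t: "t \<in> {0<..<\<tau>}" for t
    proof -
      have "((\<lambda>t. integral ?B (k e t)) has_real_derivative integral ?B (k' t)) (at t within {0<..<\<tau>})"
      proof (rule leibniz_rule_field_derivative[OF _ _ _ t])
        show "((\<lambda>t. k e t x) has_real_derivative k' t x) (at t within {0<..<\<tau>})" if "t \<in> {0<..<\<tau>}" for t x
          using k_t[OF that] by (rule has_field_derivative_at_within)
        show "k e t integrable_on ?B" if "t \<in> {0<..<\<tau>}" for t
          using slice[OF ckt that] by (rule integrable_continuous)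
        show "continuous_on ({0<..<\<tau>} \<times> ?B) (\<lambda>(t, x). k' t x)"
          unfolding case_prod_unfold by (rule continuous_on_subset[OF ck']) auto
      qed auto
      moreover have "integral ?B (k' t) = (\<Sum>i\<in>UNIV. integral ?B (F' t i))"
        using slice[OF cF' t] k'_sum[OF t]
        by (subst integral_sum[symmetric]) (auto intro: integrable_continuous intro!: integral_cong)
      ultimately show ?thesis
        using F'_int[OF t] at_within_open[OF t] by simp
    qed
    show ?thesis
    proof (rule DERIV_isconst_end[where f = "\<lambda>t. integral ?B (k e t)"])
      show "continuous_on {t'..t} (\<lambda>t. integral ?B (k e t))"
        using K_t tt by (intro DERIV_continuous_on[where D = "\<lambda>_. 0"])
          (auto intro: has_field_derivative_at_within)
    qed (use K_t tt in auto)
  qed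
  \<comment> \<open>Conservation is available only at positive times. A quarter of the slack gives L
    = t1 - 3 t0 < t1 - t0, so the ball of radius \<open>r + t0\<close> is strictly inside the cone
    at time \<open>t0\<close>.\<close>
  define t0 where "t0 = (t1 - norm x0 - r) / 4"
  have t0_eq: "4 * t0 = t1 - norm x0 - r" by (simp add: t0_def)
  have t0: "0 < t0" "t0 < t1" using t0_eq t1 t1_pos r norm_ge_zero[of x0] by linarith+
  define L where "L = norm x0 + r + t0"
  have L: "0 \<le> L" "L < t1 - t0" 
    unfolding L_def using t0_eq t0 t1 r norm_ge_zero[of x0] by linarith+
  define m where "m = (t0 - t1)\<^sup>2 - L\<^sup>2"
  have m: "0 < m"
    using power_strict_mono[OF L(2,1), of 2] by (simp add: m_def power2_commute)
  \<comment> \<open>For e \<le> \<epsilon>0 / 2 at least 3/4 of the margin \<open>m\<close>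
    survives, so the denominator stays positive down to and including e = 0.\<close>
  define \<epsilon>0 where "\<epsilon>0 = sqrt m"
  have near: "0 < kernel_den (e\<^sup>2) (t0 - t1) (\<rho> x)" if "0 \<le> e" "e \<le> \<epsilon>0 / 2" "norm x \<le> r + t0" for e x
  proof -
    have "norm (x - x0) \<le> L" using that(3) norm_triangle_ineq4[of x x0] by (simp add: L_def)
    then have "\<rho> x \<le> L\<^sup>2" unfolding \<rho>_def by (intro power_mono) auto
    moreover have "e\<^sup>2 \<le> (\<epsilon>0 / 2)\<^sup>2" using that by (intro power_mono) auto
    then have "e\<^sup>2 \<le> m / 4" using m by (simp add: \<epsilon>0_def power_divide)
    moreover have "(t0 - t1)\<^sup>2 = m + L\<^sup>2" by (simp add: m_def)
    ultimately have "0 < (t0 - t1)\<^sup>2 - e\<^sup>2 - \<rho> x" using m by simp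
    then show ?thesis by (simp add: kernel_den_def add_pos_nonneg)
  qed
  \<comment> \<open>Including e = 0 makes the parameter set compact; this is the source of a bound
    independent of e.\<close>
  have "continuous_on ({0..\<epsilon>0 / 2} \<times> cball 0 (r + t0)) (\<lambda>p. k (fst p) t0 (snd p))"
  proof -
    have c0: "continuous_on S (\<lambda>p. f (snd p) t0)"
      if "continuous_on (closure UNIV \<times> {0..\<tau>}) (\<lambda>p. f (fst p) (snd p))"
      for S :: "(real \<times> (real^3)) set" and f :: "real^3 \<Rightarrow> real \<Rightarrow> 'z::topological_space"
    proof -
      have "continuous_on S (\<lambda>p. (\<lambda>p. f (fst p) (snd p)) (snd p, t0))"
        using t0 t1 by (intro continuous_on_compose2[OF that(1)] continuous_intros) auto
      then show ?thesis by simp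
    qed
    have "kernel_den ((fst p)\<^sup>2) (t0 - t1) (\<rho> (snd p)) \<noteq> 0"
      if "p \<in> {0..\<epsilon>0 / 2} \<times> cball 0 (r + t0)" for p
      using near[of "fst p" "snd p"] that by auto
    then show ?thesis
      unfolding k_def
      by (intro continuous_intros continuous_kernel c\<rho> c0[OF cont_z] c0[OF cont_zt])
  qed
  then have "bounded ((\<lambda>p. k (fst p) t0 (snd p)) ` ({0..\<epsilon>0 / 2} \<times> cball 0 (r + t0)))"
    by (intro compact_imp_bounded compact_continuous_image compact_Times) auto
  then obtain C where C: "0 < C" "\<And>e x. e \<in> {0..\<epsilon>0 / 2} \<Longrightarrow> x \<in> cball 0 (r + t0) \<Longrightarrow> \<bar>k e t0 x\<bar> \<le> C"
    unfolding bounded_pos by fastforce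
  show ?thesis
  proof (rule singular_kernel_eq_0[of "- c" c "\<lambda>x. z x t1" x0 "\<epsilon>0 / 2" "C * measure lborel ?B"])
    show "continuous_on ?B (\<lambda>x. z x t1)"
    proof -
      have "continuous_on ?B (\<lambda>x. (\<lambda>p. z (fst p) (snd p)) (x, t1))"
        by (rule continuous_on_compose2[OF cont_z])
           (use t1 t1_pos in \<open>auto intro!: continuous_intros\<close>)
      then show ?thesis by simp
    qed
    have "x0 \<in> cball 0 (r + \<tau>)" using t1 r by simp
    then show "x0 \<in> box (- c) c" using c by blast
    show "0 < \<epsilon>0 / 2" using m by (simp add: \<epsilon>0_def)
    show "\<bar>integral ?B (\<lambda>x. z x t1 / (e\<^sup>2 + (norm (x - x0))\<^sup>2)\<^sup>2)\<bar> \<le> C * measure lborel ?B"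
      if e: "0 < e" "e < \<epsilon>0 / 2" for e
    proof -
      \<comment> \<open>At time \<open>t1\<close> the kernel is 0 and its time derivative is the
        reciprocal of \<open>kernel_den\<close>, so the term with \<open>zt\<close>
        disappears.\<close>
      have "k e t1 x = z x t1 / (e\<^sup>2 + (norm (x - x0))\<^sup>2)\<^sup>2" for x
      proof -
        have "kernel_den (e\<^sup>2) 0 (\<rho> x) = (e\<^sup>2 + \<rho> x)\<^sup>2" by (simp add: kernel_den_def power2_eq_square algebra_simps)
        then show ?thesis
          by (simp add: k_def kernel_def kernel_s_def \<rho>_def power2_eq_square)
      qed
      then have "integral ?B (\<lambda>x. z x t1 / (e\<^sup>2 + (norm (x - x0))\<^sup>2)\<^sup>2) = integral ?B (k e t1)"
        by (metis (no_types, lifting) ext)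
      also have "\<dots> = integral ?B (k e t0)" using e t0 t1 by (intro conserved) auto
      finally have eq: "integral ?B (\<lambda>x. z x t1 / (e\<^sup>2 + (norm (x - x0))\<^sup>2)\<^sup>2) = integral ?B (k e t0)" .
      have b: "norm (k e t0 x) \<le> C" for x
      proof (cases "norm x \<le> r + t0")
        case True then show ?thesis using C(2)[of e x] e by simp
      next
        case False
        then have "k e t0 x = 0" using supp[of t0 x] zt_supp[of t0 x] t0 t1 by (simp add: k_def)
        then show ?thesis using C(1) by simp
      qed
      have "norm (integral ?B (k e t0)) \<le> C * measure lborel ?B"
      \<comment> \<open>A non-integrable function has integral 0 by convention, so the bound holds
        in that case too.\<close>
      proof (cases "k e t0 integrable_on ?B")
        case True
        then show ?thesis using has_integral_bound[OF _ integrable_integral[OF True]] b C(1) by simp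
      next
        case False
        then show ?thesis using C(1) by (simp add: not_integrable_integral)
      qed
      then show ?thesis using eq by simp
    qed
  qed
qed

section \<open>Reconstruction\<close>

text \<open>The nondegenerate interval around \<open>t\<close> makes the filter
  \<open>at t within J\<close> nontrivial, so that the derivative within \<open>J\<close> is
  unique.\<close>

lemma (in wave_jet) time_deriv_eq:
  assumes "x \<in> closure D" "t \<in> J" "{a..b} \<subseteq> J" "a < b" "t \<in> {a..b}"
  shows "time_deriv J z x t = zt x t"
  unfolding time_deriv_def
proof (rule vector_derivative_within)
  have "at t within {a..b} \<noteq> bot"
    using assms by (simp add: trivial_limit_within islimpt_Icc)
  then show "at t within J \<noteq> bot"
    using at_le[OF assms(3), of t] by (metis bot.extremum_uniqueI)
  show "(z x has_vector_derivative zt x t) (at t within J)"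
    using z_t[OF assms(1,2)] by (simp add: has_real_derivative_iff_has_vector_derivative)
qed

lemma support_radius:
  fixes a b :: "real^3 \<Rightarrow> real"
  assumes "supp a \<subseteq> ball 0 1" "supp b \<subseteq> ball 0 1"
  obtains r where "0 \<le> r" "r < 1" "\<And>x. r < norm x \<Longrightarrow> a x = 0 \<and> b x = 0"
proof -
  \<comment> \<open>The point 0 keeps the set nonempty even when both data vanish
    identically.\<close>
  let ?S = "insert 0 (supp a \<union> supp b)"
  have sub: "?S \<subseteq> ball 0 1" using assms by simp
  have "closed ?S" unfolding supp_def by (intro closed_insert closed_Un closed_closure)
  moreover have "bounded ?S" using sub bounded_ball bounded_subset by blast
  ultimately have "compact ?S" by (simp add: compact_eq_bounded_closed)
  then have "\<exists>y\<in>?S. \<forall>x\<in>?S. norm x \<le> norm y"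
    by (rule continuous_attains_sup) (auto intro!: continuous_intros)
  then obtain y where y: "y \<in> ?S" "\<And>x. x \<in> ?S \<Longrightarrow> norm x \<le> norm y" by blast
  show thesis
  proof (rule that[of "norm y"])
    show "norm y < 1" using y(1) sub by auto
    show "a x = 0 \<and> b x = 0" if "norm y < norm x" for x
    proof -
      have "x \<notin> supp a" "x \<notin> supp b" using y(2)[of x] that by auto
      moreover have "{x. f x \<noteq> 0} \<subseteq> supp f" for f :: "real^3 \<Rightarrow> real"
        unfolding supp_def by (rule closure_subset)
      ultimately show ?thesis by blast
    qed
  qed simp
qed

theorem mainTheorem1:
  fixes a b V V' :: "real^3 \<Rightarrow> real"
    and u v w F :: "real^3 \<Rightarrow> real \<Rightarrow> real"
    and T :: real
  assumes T: "T \<ge> 2"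
    and supp_a: "supp a \<subseteq> ball 0 1"
    and supp_b: "supp b \<subseteq> ball 0 1"
    and u: "cauchy_solution {0..} 0 a b u"
    and F: "\<forall>x\<in>sphere 0 1. \<forall>t\<in>{0..T}. F x t = u x t"
    and v: "exterior_solution T F v"
    and V: "V = (\<lambda>x. if x \<in> ball 0 1 then 0 else v x T)"
    and V': "V' = (\<lambda>x. if x \<in> ball 0 1 then 0 else time_deriv {0..T} v x T)"
    and w: "cauchy_solution {..T} T V V' w"
  shows "supp V \<subseteq> ball 0 (T + 1) - ball 0 1 \<and>
         supp V' \<subseteq> ball 0 (T + 1) - ball 0 1 \<and>
         (\<forall>x\<in>ball 0 1. a x = w x 0 \<and> b x = time_deriv {..T} w x 0)"
proof -
  obtain r where r: "0 \<le> r" "r < 1" "\<And>x. r < norm x \<Longrightarrow> a x = 0 \<and> b x = 0"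
    using support_radius[OF supp_a supp_b] by blast
  have u_sol: "wave_solution UNIV {0..} u" and ua: "\<And>x. u x 0 = a x"
    and ub: "\<And>x. time_deriv {0..} u x 0 = b x"
    using u unfolding cauchy_solution_def by auto
  obtain ut utt ux uxt uxx where ujet: "wave_jet UNIV {0..} u ut utt ux uxt uxx"
    using wave_solution_jet[OF u_sol open_UNIV] by blast
  interpret U: wave_jet UNIV "{0..}" u ut utt ux uxt uxx by fact
  have ut0: "ut x 0 = b x" for x
    using U.time_deriv_eq[of x 0 0 1] ub by simp
  have ujet': "wave_jet UNIV {0..\<tau>} u ut utt ux uxt uxx" for \<tau>
    by (rule wave_jet_restrict[OF ujet]) auto
  have u_out: "u x t = 0" if "0 \<le> t" "r + t < norm x" for x t
  \<comment> \<open>The base of this cone is the ball about \<open>x\<close> of radius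
    \<open>norm x - r\<close>, which misses the data.\<close>
  proof (rule domain_of_dependence[OF ujet', of "norm x - r" "norm x - r" x])
    fix y assume "norm (y - x) < norm x - r"
    then have "r < norm y" using norm_triangle_ineq4[of y "y - x"] by simp
    then show "u y 0 = 0 \<and> ut y 0 = 0" using r(3)[of y] ua ut0 by simp
  qed (use that in auto)
  have u_in: "u x t = 0" if "norm x + r < t" for x t
    \<comment> \<open>The time interval is prolonged to \<open>t + 1\<close> so that
      \<open>t\<close> is an interior time.\<close>
    by (rule huygens[OF ujet'[of "t + 1"], of r]) (use that r u_out in auto)
  have ut_in: "ut x t = 0" if "norm x + r < t" for x t
  proof -
    have t: "0 < t" using that r norm_ge_zero[of x] by linarith
    have "(u x has_real_derivative ut x t) (at t)"
      using U.z_t[of x t] t at_within_interior[of t "{0..}"] by simp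
    moreover have "(u x has_real_derivative 0) (at t)"
      by (rule has_field_derivative_transform_within_open[OF DERIV_const, of "{norm x + r<..}"])
         (use that u_in in auto)
    ultimately show ?thesis by (rule DERIV_unique)
  qed
  have ut_out: "ut x t = 0" if "0 < t" "r + t < norm x" for x t
  proof -
    have "(u x has_real_derivative ut x t) (at t)"
      using U.z_t[of x t] that at_within_interior[of t "{0..}"] by simp
    moreover have "(u x has_real_derivative 0) (at t)"
      by (rule has_field_derivative_transform_within_open[OF DERIV_const, of "{0<..} \<inter> {..<norm x - r}"])
         (use that u_out in auto)
    ultimately show ?thesis by (rule DERIV_unique)
  qed
  have v_sol: "wave_solution (- cball 0 1) {0..T} v"
    and v0: "\<And>x. 1 \<le> norm x \<Longrightarrow> v x 0 = 0 \<and> time_deriv {0..T} v x 0 = 0"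
    and vF: "\<And>x t. norm x = 1 \<Longrightarrow> 0 \<le> t \<Longrightarrow> t \<le> T \<Longrightarrow> v x t = u x t"
    using v F unfolding exterior_solution_def by auto
  have oD: "open (- cball (0::real^3) 1)" by (simp add: open_Compl)
  have cl: "closure (- cball 0 1) = - ball (0::real^3) 1"
    by (simp add: closure_complement interior_cball)
  obtain vt vtt vx vxt vxx where vjet: "wave_jet (- cball 0 1) {0..T} v vt vtt vx vxt vxx"
    using wave_solution_jet[OF v_sol oD] by blast
  interpret V: wave_jet "- cball 0 1" "{0..T}" v vt vtt vx vxt vxx by fact
  have vt0: "vt x 0 = 0" if "1 < norm x" for x
    using V.time_deriv_eq[of x 0 0 T] v0[of x] that T by (simp add: cl)
  have vu: "v x t = u x t" if "1 \<le> norm x" "0 \<le> t" "t \<le> T" for x t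
  proof (cases "norm x = 1")
    case False
    have "v x t - u x t = 0"
    proof (rule exterior_uniqueness[OF wave_jet_diff[OF vjet wave_jet_restrict[OF ujet'[of T] oD subset_UNIV order_refl]]])
      show "v y 0 - u y 0 = 0 \<and> vt y 0 - ut y 0 = 0" if "1 < norm y" for y
        using that v0[of y] vt0[of y] ua ut0 r(2) r(3)[of y] by simp
    qed (use that False vF in auto)
    then show ?thesis by simp
  qed (use that vF in simp)
  \<comment> \<open>For |x| < 1 we have |x| + r < 2 \<le> T, so the extension of \<open>V\<close> by
    zero agrees with \<open>u\<close>, which has left the ball.\<close>
  have VT: "V x = u x T" for x
    using u_in[of x T] vu[of x T] T r by (cases "norm x < 1") (auto simp: V)
  have V'T: "V' x = ut x T" for x
  proof (cases "norm x < 1")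
    case True
    then show ?thesis using ut_in[of x T] T r by (simp add: V')
  next
    case False
    \<comment> \<open>The interval of \<open>v\<close> ends at \<open>T\<close>, so both derivatives
      are compared from the left, where the functions agree.\<close>
    have "vt x T = ut x T"
    proof -
      have "(v x has_vector_derivative vt x T) (at T within {0..T})"
        using V.z_t[of x T] False T by (simp add: cl has_real_derivative_iff_has_vector_derivative)
      moreover have "(u x has_vector_derivative ut x T) (at T within {0..T})"
        using has_field_derivative_subset[OF U.z_t[of x T], of "{0..T}"] T
        by (auto simp: has_real_derivative_iff_has_vector_derivative)
      then have "(v x has_vector_derivative ut x T) (at T within {0..T})"
        by (rule has_vector_derivative_transform[rotated 2]) (use vu False T in auto)
      ultimately show ?thesis
        using vector_derivative_unique_within_closed_interval[of 0 T T] T by auto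
    qed
    moreover have "time_deriv {0..T} v x T = vt x T"
      using V.time_deriv_eq[of x T 0 T] False T by (simp add: cl)
    ultimately show ?thesis using False by (simp add: V')
  qed
  \<comment> \<open>The gap r < 1 leaves room for the closure inside the open ball of radius T +
    1.\<close>
  have supp: "supp f \<subseteq> ball 0 (T + 1) - ball 0 1"
    if "\<And>x. norm x < 1 \<Longrightarrow> f x = 0" "\<And>x. r + T < norm x \<Longrightarrow> f x = 0" for f :: "real^3 \<Rightarrow> real"
  proof -
    have "closed (cball (0::real^3) (r + T) - ball 0 1)" by (intro closed_Diff) auto
    moreover have "{x. f x \<noteq> 0} \<subseteq> cball 0 (r + T) - ball 0 1"
      using that by (force simp: not_less[symmetric])
    ultimately have "supp f \<subseteq> cball 0 (r + T) - ball 0 1"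
      unfolding supp_def by (rule closure_minimal[rotated])
    then show ?thesis using r(2) by force
  qed
  have "supp V \<subseteq> ball 0 (T + 1) - ball 0 1"
  proof (rule supp)
    show "V x = 0" if "norm x < 1" for x using that by (simp add: V)
    show "V x = 0" if "r + T < norm x" for x unfolding VT using that T by (intro u_out) auto
  qed
  moreover have "supp V' \<subseteq> ball 0 (T + 1) - ball 0 1"
  proof (rule supp)
    show "V' x = 0" if "norm x < 1" for x using that by (simp add: V')
    show "V' x = 0" if "r + T < norm x" for x unfolding V'T using that T by (intro ut_out) auto
  qed
  moreover have "a x = w x 0 \<and> b x = time_deriv {..T} w x 0" for x
  proof -
    have w_sol: "wave_solution UNIV {..T} w" and wT: "\<And>x. w x T = V x"
      and wT': "\<And>x. time_deriv {..T} w x T = V' x"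
      using w unfolding cauchy_solution_def by auto
    obtain wt wtt wx wxt wxx where wjet: "wave_jet UNIV {..T} w wt wtt wx wxt wxx"
      using wave_solution_jet[OF w_sol open_UNIV] by blast
    interpret W: wave_jet UNIV "{..T}" w wt wtt wx wxt wxx by fact
    have wtT: "wt x T = V' x" for x
      using W.time_deriv_eq[of x T 0 T] wT' T by simp
    have wjet': "wave_jet UNIV {0..T} w wt wtt wx wxt wxx"
      by (rule wave_jet_restrict[OF wjet]) auto
    have wu: "w x t = u x t" if "0 \<le> t" "t \<le> T" for t
    proof -
      \<comment> \<open>After time reversal \<open>T\<close> is the initial time. The data of w - u
        vanish everywhere, so a cone centred at \<open>x\<close> itself with any radius above
        \<open>T\<close> will do.\<close>
      have "w x (T - (T - t)) - u x (T - (T - t)) = 0"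
        by (rule domain_of_dependence[OF wave_jet_time_reversal[OF wave_jet_diff[OF wjet' ujet'[of T]]],
              of "T + 1" x])
           (use that wT wtT VT V'T in auto)
      then show ?thesis by simp
    qed
    \<comment> \<open>\<open>w\<close> and \<open>u\<close> are known to agree only on [0, T], so
      their derivatives at 0 are compared from the right.\<close>
    have "wt x 0 = ut x 0"
    proof -
      have "(w x has_vector_derivative wt x 0) (at 0 within {0..T})"
        using has_field_derivative_subset[OF W.z_t[of x 0], of "{0..T}"] T
        by (auto simp: has_real_derivative_iff_has_vector_derivative)
      moreover have "(u x has_vector_derivative ut x 0) (at 0 within {0..T})"
        using has_field_derivative_subset[OF U.z_t[of x 0], of "{0..T}"] T
        by (auto simp: has_real_derivative_iff_has_vector_derivative)
      then have "(w x has_vector_derivative ut x 0) (at 0 within {0..T})"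
        by (rule has_vector_derivative_transform[rotated 2]) (use wu T in auto)
      ultimately show ?thesis
        using vector_derivative_unique_within_closed_interval[of 0 T 0] T by auto
    qed
    moreover have "time_deriv {..T} w x 0 = wt x 0"
      using W.time_deriv_eq[of x 0 0 T] T by simp
    ultimately show ?thesis using wu[of 0] ua ut0 T by simp
  qed
  ultimately show ?thesis by blast
qed

end
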